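(* Let $n\ge1$, $N\ge0$ be integers and consider the discrete symplectic system $y_{k+1}(\lambda)=W_k(\lambda)y_k(\lambda)$, $W_k^T(\lambda)\mathcal JW_k(\lambda)=\mathcal J$, $k\in[0,N]_{\mathbb Z}$, such that the symplectic matrix $W_k(\lambda)\in C_p^1$ satisfies $\Psi(W_k(\lambda))\ge0$ for $k\in[0,N]_{\mathbb Z}$, $\lambda\in\mathbb R$. Assume that $\mathcal Z_k(\lambda)$, $k\in[0,N+1]_{\mathbb Z}$, is a symplectic fundamental matrix of this system with $\mathcal Z_0(\lambda)\in C_p^1$ and $\Psi(\mathcal Z_0(\lambda))\ge0$, $\lambda\in\mathbb R$. Let $\mathcal Y_k(\lambda)$ be the conjoined basis of the system with $\mathcal Y_0(\lambda)=\mathcal Z_0(\lambda)\binom0I$, and let $a<b$. Then for every $k\in[0,N]_{\mathbb Z}$ $$-\Delta l_c(\mathcal Y_k,a,b)+l_c\big(W_k\tbinom0I,a,b\big)=\mu\big(\mathcal Y_{k+1}(\lambda),W_k(\lambda)\tbinom0I\big)\Big|_{\lambda=b}^{\lambda=a}=m_d(\mathcal Y_k(a))-m_d(\mathcal Y_k(b)).$$ Moreover, $$l_c(\mathcal Y_{N+1},a,b)-l_c(\mathcal Y_0,a,b)-\sum_{k=0}^Nl_c\big(W_k\tbinom0I,a,b\big)=l_d(\mathcal Y(b),0,N+1)-l_d(\mathcal Y(a),0,N+1).$$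
   Context: Notation: $[M,N]_{\mathbb Z}=[M,N]\cap\mathbb Z$; $\mathcal J=\begin{pmatrix}0&I\\-I&0\end{pmatrix}$, matrices are real, $W_k(\lambda)$ is $2n\times2n$; $\binom{0}{I}$ is the $2n\times n$ matrix with $n\times n$ blocks $0,I$; $C_p^1$ means continuous in $\lambda\in\mathbb R$ with piecewise continuous derivative; $A^\dagger$ is the Moore-Penrose inverse; $\operatorname{ind}A$ is the number of negative eigenvalues of a symmetric $A$; $A\ge0$ means symmetric nonnegative definite; $\operatorname{rank}A(\lambda^-)$ is the left-hand limit of $\operatorname{rank}A(\cdot)$ at $\lambda$; $\Delta A_k=A_{k+1}-A_k$; $f(\lambda)|_{\lambda=b}^{\lambda=a}=f(a)-f(b)$. For a symplectic $C^1_p$ function $S(\lambda)$, $\Psi(S(\lambda))=\mathcal J^T\dot S(\lambda)S^{-1}(\lambda)$ (a symmetric matrix). Continuous focal points: for a $2n\times n$ matrix function $Y(\lambda)=\binom{X(\lambda)}{U(\lambda)}$, $l_c(Y,a,b)=\sum_{\tau\in(a,b]}\big(\operatorname{rank}X(\tau^-)-\operatorname{rank}X(\tau)\big)$, the total number of (left) proper focal points in $(a,b]$ (under the hypotheses, the rank limits exist and only finitely many terms are nonzero). Discrete focal points: a conjoined basis of $y_{k+1}=W_ky_k$, $W_k=\begin{pmatrix}A_k&B_k\\C_k&D_k\end{pmatrix}$, is a $2n\times n$ matrix solution $Y_k=\binom{X_k}{U_k}$ with $\operatorname{rank}Y_k=n$, $X_k^TU_k=U_k^TX_k$. Its multiplicity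 of forward focal points in $(k,k+1]$ is $m_d(Y_k)=\operatorname{rank}M_k+\operatorname{ind}P_k$, where $M_k=(I-X_{k+1}X_{k+1}^\dagger)B_k$, $T_k=I-M_k^\dagger M_k$, $P_k=T_kX_kX_{k+1}^\dagger B_kT_k$ (symmetric), and $l_d(Y,0,N+1)=\sum_{k=0}^Nm_d(Y_k)$. Comparative index: for $2n\times n$ matrices $Y=\binom XU$, $\hat Y=\binom{\hat X}{\hat U}$ of rank $n$ with $X^TU$, $\hat X^T\hat U$ symmetric, $\mu(Y,\hat Y)=\operatorname{rank}\mathcal M+\operatorname{ind}\mathcal D$, where $\mathcal M=(I-XX^\dagger)\hat X$, $\mathcal T=I-\mathcal M^\dagger\mathcal M$, $\mathcal D=\mathcal T\,w^T(Y,\hat Y)X^\dagger\hat X\,\mathcal T$, $w(Y,\hat Y)=Y^T\mathcal J\hat Y$. *)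

theory Defs
  imports "HOL-Analysis.Analysis"
begin

text \<open>Matrices with \<open>2n\<close> rows are indexed by the sum type \<open>'n + 'n\<close>,
  where \<open>n\<close> is the cardinality of \<open>'n\<close>: \<open>Inl\<close> addresses the first and \<open>Inr\<close> the
  second group of \<open>n\<close> indices.\<close>

definition block4 ::
  "'a^'n^'n \<Rightarrow> 'a^'n^'n \<Rightarrow> 'a^'n^'n \<Rightarrow> 'a^'n^'n \<Rightarrow> 'a^('n + 'n)^('n + 'n)" where
  "block4 A B C D = (\<chi> i j. case i of
      Inl i' \<Rightarrow> (case j of Inl j' \<Rightarrow> A $ i' $ j' | Inr j' \<Rightarrow> B $ i' $ j')
    | Inr i' \<Rightarrow> (case j of Inl j' \<Rightarrow> C $ i' $ j' | Inr j' \<Rightarrow> D $ i' $ j'))"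

definition block2 :: "'a^'n^'n \<Rightarrow> 'a^'n^'n \<Rightarrow> 'a^'n^('n + 'n)" where
  "block2 X U = (\<chi> i j. case i of Inl i' \<Rightarrow> X $ i' $ j | Inr i' \<Rightarrow> U $ i' $ j)"

definition upper_block :: "'a^'n^('n + 'n) \<Rightarrow> 'a^'n^'n" where
  "upper_block Y = (\<chi> i j. Y $ Inl i $ j)"

definition lower_block :: "'a^'n^('n + 'n) \<Rightarrow> 'a^'n^'n" where
  "lower_block Y = (\<chi> i j. Y $ Inr i $ j)"

definition upper_right_block :: "'a^('n + 'n)^('n + 'n) \<Rightarrow> 'a^'n^'n" where
  "upper_right_block W = (\<chi> i j. W $ Inl i $ Inr j)"

definition JJ :: "real^('n::finite + 'n)^('n + 'n)" where
  "JJ = block4 0 (mat 1) (- mat 1) 0"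

definition col0I :: "real^'n::finite^('n + 'n)" where
  "col0I = block2 0 (mat 1)"

definition symplectic :: "real^('n::finite + 'n)^('n + 'n) \<Rightarrow> bool" where
  "symplectic S \<longleftrightarrow> transpose S ** JJ ** S = JJ"

definition symmetric_mat :: "real^'n^'n \<Rightarrow> bool" where
  "symmetric_mat A \<longleftrightarrow> transpose A = A"

definition nonneg_definite :: "real^'n::finite^'n \<Rightarrow> bool" where
  "nonneg_definite A \<longleftrightarrow> symmetric_mat A \<and> (\<forall>v. 0 \<le> v \<bullet> (A *v v))"

text \<open>The Moore-Penrose inverse, characterized by the four Penrose equations.\<close>

definition is_pinv :: "real^'n::finite^'m::finite \<Rightarrow> real^'m^'n \<Rightarrow> bool" where
  "is_pinv A G \<longleftrightarrow> A ** G ** A = A \<and> G ** A ** G = G \<and>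
     symmetric_mat (A ** G) \<and> symmetric_mat (G ** A)"

definition pinv :: "real^'n::finite^'m::finite \<Rightarrow> real^'m^'n" where
  "pinv A = (THE G. is_pinv A G)"

text \<open>Negative eigenvalues are counted with multiplicity. For symmetric matrices the
  geometric multiplicity used here agrees with the algebraic one.\<close>

definition ind :: "real^'n::finite^'n \<Rightarrow> nat" where
  "ind A = (\<Sum>r | r < 0 \<and> (\<exists>v. v \<noteq> 0 \<and> A *v v = r *\<^sub>R v). dim {v. A *v v = r *\<^sub>R v})"

text \<open>Continuous functions on the real line with piecewise continuous derivative: outside a
  locally finite set the derivative exists and is continuous, and at the exceptional points
  it has finite one-sided limits.\<close>

definition C1p :: "(real \<Rightarrow> 'a::real_normed_vector) \<Rightarrow> bool" where
  "C1p f \<longleftrightarrow> continuous_on UNIV f \<and>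
     (\<exists>E f'. (\<forall>c d. finite (E \<inter> {c..d})) \<and>
        (\<forall>t\<in>-E. (f has_vector_derivative f' t) (at t)) \<and>
        continuous_on (-E) f' \<and>
        (\<forall>t\<in>E. (\<exists>l. (f' \<longlongrightarrow> l) (at_left t)) \<and> (\<exists>r. (f' \<longlongrightarrow> r) (at_right t))))"

definition Psi :: "(real \<Rightarrow> real^('n::finite + 'n)^('n + 'n)) \<Rightarrow> real \<Rightarrow> real^('n + 'n)^('n + 'n)" where
  "Psi S t = transpose JJ ** vector_derivative S (at t) ** matrix_inv (S t)"

text \<open>For a function in \<open>C1p\<close> the derivative may fail to exist at isolated points. There,
  nonnegativity of both one-sided limits of \<open>Psi S\<close> follows from the nearby points.\<close>

definition Psi_nonneg :: "(real \<Rightarrow> real^('n::finite + 'n)^('n + 'n)) \<Rightarrow> bool" where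
  "Psi_nonneg S \<longleftrightarrow> (\<forall>t. S differentiable (at t) \<longrightarrow> nonneg_definite (Psi S t))"

text \<open>Left proper focal points in \<open>(a, b]\<close>; \<open>supp_sum\<close> adds up the nonzero terms.\<close>

definition l_c :: "(real \<Rightarrow> real^'n::finite^('n + 'n)) \<Rightarrow> real \<Rightarrow> real \<Rightarrow> int" where
  "l_c Y a b = supp_sum (\<lambda>t. Lim (at_left t) (\<lambda>s. int (rank (upper_block (Y s))))
                              - int (rank (upper_block (Y t)))) {a<..b}"

text \<open>In the following, \<open>W\<close> and \<open>Y\<close> are sequences in \<open>k\<close> (for a fixed value of the spectral
  parameter).\<close>

definition conjoined_basis ::
  "nat \<Rightarrow> (nat \<Rightarrow> real^('n::finite + 'n)^('n + 'n)) \<Rightarrow> (nat \<Rightarrow> real^'n^('n + 'n)) \<Rightarrow> bool" where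
  "conjoined_basis N W Y \<longleftrightarrow>
     (\<forall>k\<le>N. Y (Suc k) = W k ** Y k) \<and>
     (\<forall>k\<le>Suc N. rank (Y k) = CARD('n) \<and>
        transpose (upper_block (Y k)) ** lower_block (Y k)
          = transpose (lower_block (Y k)) ** upper_block (Y k))"

definition symplectic_fundamental_matrix ::
  "nat \<Rightarrow> (nat \<Rightarrow> real^('n::finite + 'n)^('n + 'n)) \<Rightarrow> (nat \<Rightarrow> real^('n + 'n)^('n + 'n)) \<Rightarrow> bool" where
  "symplectic_fundamental_matrix N W Z \<longleftrightarrow>
     (\<forall>k\<le>N. Z (Suc k) = W k ** Z k) \<and> (\<forall>k\<le>Suc N. symplectic (Z k))"

definition m_d ::
  "(nat \<Rightarrow> real^('n::finite + 'n)^('n + 'n)) \<Rightarrow> (nat \<Rightarrow> real^'n^('n + 'n)) \<Rightarrow> nat \<Rightarrow> nat" where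
  "m_d W Y k =
     (let X = upper_block (Y k); X' = upper_block (Y (Suc k)); B = upper_right_block (W k);
          M = (mat 1 - X' ** pinv X') ** B;
          T = mat 1 - pinv M ** M;
          P = T ** X ** pinv X' ** B ** T
      in rank M + ind P)"

definition l_d ::
  "(nat \<Rightarrow> real^('n::finite + 'n)^('n + 'n)) \<Rightarrow> (nat \<Rightarrow> real^'n^('n + 'n)) \<Rightarrow> nat \<Rightarrow> nat \<Rightarrow> nat" where
  "l_d W Y K L = (\<Sum>k\<in>{K..<L}. m_d W Y k)"

definition wronskian :: "real^'n::finite^('n + 'n) \<Rightarrow> real^'n^('n + 'n) \<Rightarrow> real^'n^'n" where
  "wronskian Y Y' = transpose Y ** JJ ** Y'"

definition comparative_index :: "real^'n::finite^('n + 'n) \<Rightarrow> real^'n^('n + 'n) \<Rightarrow> nat" where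
  "comparative_index Y Y' =
     (let X = upper_block Y; X' = upper_block Y';
          M = (mat 1 - X ** pinv X) ** X';
          T = mat 1 - pinv M ** M;
          D = T ** transpose (wronskian Y Y') ** pinv X ** X' ** T
      in rank M + ind D)"

end

theory Submission
  imports Defs
begin

text \<open>Write \<open>V\<close> for the column space of \<open>(0; I)\<close>. The column spaces of \<open>Y\<^sub>k\<^sub>+\<^sub>1 = W\<^sub>k Y\<^sub>k\<close> and of
  \<open>W\<^sub>k (0; I)\<close> are Lagrangian, and the three kinds of focal points in the formula record how these
  two subspaces and \<open>V\<close> meet pairwise: \<open>n - rank X\<^sub>k\<^sub>+\<^sub>1\<close> is the dimension of \<open>Y\<^sub>k\<^sub>+\<^sub>1 \<inter> V\<close>,
  the upper block of \<open>W\<^sub>k (0; I)\<close> gives in the same way the dimension of \<open>W\<^sub>k V \<inter> V\<close>, and, since \<open>W\<^sub>k\<close> is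
  invertible, \<open>n - rank X\<^sub>k\<close> is the dimension of \<open>Y\<^sub>k\<^sub>+\<^sub>1 \<inter> W\<^sub>k V\<close>.

  Near a fixed parameter value \<open>\<tau>\<close> a shear \<open>(x, u) \<mapsto> (x, u - k x)\<close> with a suitable number \<open>k\<close> turns
  both subspaces into graphs \<open>{(P w, w)}\<close> and \<open>{(R w, w)}\<close> of symmetric matrices, while \<open>V\<close> becomes
  the graph of \<open>0\<close> (\<open>finite_singular_shears\<close>). The comparative index is then a combination of
  negative indices, \<open>\<mu> = ind (P - R) + ind R - ind P\<close> (\<open>comparative_index_of_graphs\<close>). This is
  an instance of the inertia formula for a block matrix and its generalized Schur complement: the form
  \<open>x \<bullet> (P - R) x + y \<bullet> R y\<close> on pairs becomes \<open>x \<bullet> P x + 2 (x \<bullet> R u) + u \<bullet> R u\<close> for \<open>y = x + u\<close>.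

  Each of the three indices loses exactly the corresponding focal points. The condition
  \<open>\<Psi> \<ge> 0\<close> makes slopes nondecreasing (\<open>slope_nondecreasing\<close>), and for a continuous nondecreasing
  symmetric \<open>Q\<close> the number of negative eigenvalues is nonincreasing and right-continuous while the
  number of positive ones is nondecreasing and left-continuous. As the rank is the sum of the two, its
  drop from the left limit to the value at a point is the drop of \<open>ind Q\<close>
  (\<open>l_c_eq_ind_diff_local\<close>). This applies to \<open>P\<close> and \<open>R\<close> directly. The difference \<open>P - R\<close> need not be
  monotone; but if \<open>Y\<^sub>k\<close> is taken at parameter \<open>s\<close> and \<open>W\<^sub>k\<close> at parameter \<open>t\<close>, then the rank of
  \<open>P - R\<close> is the rank of \<open>X\<^sub>k\<close> at \<open>s\<close>, so the index of \<open>P - R\<close> is constant in \<open>t\<close>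
  (\<open>ind_constant_if_rank_constant\<close>), and one may put \<open>t = \<tau>\<close>, where \<open>R\<close> is fixed and \<open>P\<close> is
  nondecreasing in \<open>s\<close>.

  The local identities add up over \<open>(a, b]\<close> by bisection. Finally, the Wronskian of
  \<open>W\<^sub>k Y\<^sub>k\<close> and \<open>W\<^sub>k (0; I)\<close> is the transpose of \<open>X\<^sub>k\<close>, so that the comparative index equals the
  multiplicity of discrete focal points (\<open>m_d_eq_comparative_index\<close>), and the global formula is
  the telescoping sum.\<close>

section \<open>The negative index of a symmetric matrix\<close>

lemma symmetric_mat_inner:
  fixes A :: "real^'n::finite^'n"
  assumes "symmetric_mat A"
  shows "v \<bullet> (A *v w) = (A *v v) \<bullet> w"
  using assms unfolding symmetric_mat_def
  by (metis dot_lmul_matrix transpose_matrix_vector)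

lemma inner_matrix_vector_transpose:
  fixes A :: "real^'n::finite^'m::finite"
  shows "v \<bullet> (A *v w) = (transpose A *v v) \<bullet> w"
  by (simp add: dot_lmul_matrix)

lemma uminus_matrix_vector: "(- A :: real^'n::finite^'m::finite) *v w = - (A *v w)"
  by (simp add: matrix_vector_mult_def vec_eq_iff sum_negf)

lemma symmetric_mat_uminus: "symmetric_mat A \<Longrightarrow> symmetric_mat (- A)"
  by (simp add: symmetric_mat_def transpose_def vec_eq_iff)

text \<open>The first-order condition at the minimum of a quadratic polynomial.\<close>

lemma linear_coeff_eq_0_if_quadratic_nonneg:
  fixes p q :: real
  assumes "\<And>t. 0 \<le> 2 * t * p + t\<^sup>2 * q"
  shows "p = 0"
proof (rule ccontr)
  assume "p \<noteq> 0"
  define s where "s = \<bar>q\<bar> + 1"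
  define t where "t = - p / s"
  have "s > 0" by (simp add: s_def)
  have "2 * t * p + t\<^sup>2 * q \<le> 2 * t * p + t\<^sup>2 * s"
    unfolding s_def by (intro add_left_mono mult_left_mono) auto
  also have "\<dots> = - p\<^sup>2 / s"
    using \<open>s > 0\<close> unfolding t_def by (simp add: field_simps power2_eq_square)
  also have "\<dots> < 0"
    using \<open>p \<noteq> 0\<close> \<open>s > 0\<close> by (simp add: divide_neg_pos)
  finally show False
    using assms[of t] by simp
qed

text \<open>A minimizer \<open>v\<close> of the quadratic form on the unit sphere of \<open>S\<close> is an eigenvector: the first
  variation gives \<open>w \<bullet> (A v - c v) = 0\<close> for all \<open>w\<close> in \<open>S\<close>, and by invariance \<open>A v - c v\<close> itself is
  such a \<open>w\<close>.\<close>

lemma rayleigh_minimum_eigenvector: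
  fixes A :: "real^'n::finite^'n"
  assumes sym: "symmetric_mat A" and S: "subspace S" "S \<noteq> {0}"
    and inv: "\<And>v. v \<in> S \<Longrightarrow> A *v v \<in> S"
  obtains v c where "v \<in> S" "norm v = 1" "A *v v = c *\<^sub>R v"
    "\<And>w. w \<in> S \<Longrightarrow> c * (w \<bullet> w) \<le> w \<bullet> (A *v w)"
proof -
  define q where "q = (\<lambda>w. w \<bullet> (A *v w))"
  let ?K = "S \<inter> sphere 0 1"
  have comp: "compact ?K"
    using S(1) by (intro closed_Int_compact closed_subspace) auto
  obtain u where "u \<in> S" "u \<noteq> 0"
    using S subspace_0 by fastforce
  then have "u /\<^sub>R norm u \<in> ?K"
    using S(1) by (auto simp: subspace_scale)
  then have "?K \<noteq> {}" by blast
  moreover have "continuous_on ?K q"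
    unfolding q_def
    by (intro continuous_intros linear_continuous_on) auto
  ultimately obtain v where v: "v \<in> ?K" and min: "\<And>w. w \<in> ?K \<Longrightarrow> q v \<le> q w"
    using continuous_attains_inf[OF comp] by metis
  define c where "c = q v"
  have vS: "v \<in> S" and nv: "norm v = 1" using v by auto
  have low: "c * (w \<bullet> w) \<le> q w" if "w \<in> S" for w
  proof (cases "w = 0")
    case False
    have "w /\<^sub>R norm w \<in> ?K"
      using that S(1) False by (auto simp: subspace_scale)
    from min[OF this] have "c \<le> q (w /\<^sub>R norm w)" by (simp add: c_def)
    also have "\<dots> = q w / (w \<bullet> w)"
      unfolding q_def
      by (simp add: matrix_vector_mult_scaleR field_simps dot_square_norm power2_eq_square)
    finally show ?thesis
      using False by (simp add: field_simps)
  qed (simp add: q_def)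
  have "w \<bullet> (A *v v - c *\<^sub>R v) = 0" if "w \<in> S" for w
  proof (rule linear_coeff_eq_0_if_quadratic_nonneg)
    fix t
    have vv: "v \<bullet> v = 1" using nv by (simp add: dot_square_norm)
    have "v + t *\<^sub>R w \<in> S" using vS that S(1) by (simp add: subspace_add subspace_scale)
    from low[OF this]
    have "0 \<le> q (v + t *\<^sub>R w) - c * ((v + t *\<^sub>R w) \<bullet> (v + t *\<^sub>R w))" by simp
    also have "q (v + t *\<^sub>R w) = q v + 2 * t * (w \<bullet> (A *v v)) + t\<^sup>2 * q w"
      unfolding q_def using symmetric_mat_inner[OF sym, of v w]
      by (simp add: matrix_vector_right_distrib matrix_vector_mult_scaleR inner_add_left
          inner_add_right inner_commute algebra_simps power2_eq_square)
    also have "c * ((v + t *\<^sub>R w) \<bullet> (v + t *\<^sub>R w)) = c + 2 * t * c * (w \<bullet> v) + t\<^sup>2 * c * (w \<bullet> w)"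
      using vv by (simp add: inner_add_left inner_add_right inner_commute algebra_simps power2_eq_square)
    finally show "0 \<le> 2 * t * (w \<bullet> (A *v v - c *\<^sub>R v)) + t\<^sup>2 * (q w - c * (w \<bullet> w))"
      unfolding c_def by (simp add: algebra_simps inner_diff_right)
  qed
  from this[of "A *v v - c *\<^sub>R v"] have "A *v v = c *\<^sub>R v"
    using inv vS S(1) by (simp add: subspace_diff subspace_scale)
  with that vS nv low show thesis unfolding q_def by blast
qed

lemma dim_orthogonal_complement:
  fixes N :: "'a::euclidean_space set"
  assumes "subspace N"
  shows "dim {v. \<forall>w\<in>N. w \<bullet> v = 0} + dim N = DIM('a)"
  using dim_subspace_orthogonal_to_vectors[OF assms subspace_UNIV subset_UNIV]
  by (simp add: orthogonal_def)

lemma subspace_orthogonal_complement: "subspace {v. \<forall>w\<in>N. w \<bullet> v = 0}"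
  by (auto simp: subspace_def inner_add_right)

lemma dim_add_le_if_trivial_Int:
  fixes H :: "'a::euclidean_space set"
  assumes "subspace H" "subspace K" "\<And>v. v \<in> H \<Longrightarrow> v \<in> K \<Longrightarrow> v = 0"
  shows "dim H + dim K \<le> DIM('a)"
proof -
  have "H \<inter> K = {0}" using assms subspace_0 by blast
  then have "dim {x + y |x y. x \<in> H \<and> y \<in> K} = dim H + dim K"
    using dim_sums_Int[OF assms(1,2)] by simp
  then show ?thesis
    using dim_subset_UNIV[of "{x + y |x y. x \<in> H \<and> y \<in> K}"] by linarith
qed

lemma subspace_eigenspace: "subspace {v. (A::real^'n::finite^'n) *v v = r *\<^sub>R v}"
  by (auto simp: subspace_def matrix_vector_right_distrib matrix_vector_mult_scaleR scaleR_add_right)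

lemma eigenvectors_orthogonal:
  fixes A :: "real^'n::finite^'n"
  assumes "symmetric_mat A" "A *v v = r *\<^sub>R v" "A *v w = s *\<^sub>R w" "r \<noteq> s"
  shows "v \<bullet> w = 0"
  using symmetric_mat_inner[OF assms(1), of v w] assms(2-4) by simp

text \<open>\<open>N\<close> is the span of all eigenvectors with negative eigenvalue. Both \<open>N\<close> and its orthogonal complement are
  invariant, so an extremal eigenvector that violated the sign claim on one of them would have to lie in
  the other one. Knowing that \<open>N\<close> lies in the range of \<open>A\<close> matters when \<open>A\<close> is compressed to a
  subspace, and for the comparison of the index with the rank.\<close>

lemma ind_decomposition:
  fixes A :: "real^'n::finite^'n"
  assumes sym: "symmetric_mat A"
  obtains N where "subspace N" "dim N = ind A"
    "\<And>v. v \<in> N \<Longrightarrow> v \<noteq> 0 \<Longrightarrow> v \<bullet> (A *v v) < 0"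
    "\<And>v. (\<And>w. w \<in> N \<Longrightarrow> w \<bullet> v = 0) \<Longrightarrow> 0 \<le> v \<bullet> (A *v v)"
    "\<And>v w. w \<in> N \<Longrightarrow> (\<And>w. w \<in> N \<Longrightarrow> w \<bullet> v = 0) \<Longrightarrow> w \<bullet> (A *v v) = 0"
    "N \<subseteq> range ((*v) A)"
proof -
  define Eig where "Eig = (\<lambda>r. {v. A *v v = r *\<^sub>R v})"
  define R where "R = {r. r < 0 \<and> (\<exists>v. v \<noteq> 0 \<and> A *v v = r *\<^sub>R v)}"
  have subE: "subspace (Eig r)" for r
    unfolding Eig_def by (rule subspace_eigenspace)
  have "\<forall>r. \<exists>B. B \<subseteq> Eig r \<and> pairwise orthogonal B \<and> (\<forall>x\<in>B. norm x = 1) \<and> independent B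
      \<and> card B = dim (Eig r) \<and> span B = Eig r"
    using orthonormal_basis_subspace[OF subE] by metis
  then obtain B where B: "\<And>r. B r \<subseteq> Eig r" "\<And>r. pairwise orthogonal (B r)"
      "\<And>r x. x \<in> B r \<Longrightarrow> norm x = 1" "\<And>r. independent (B r)"
      "\<And>r. card (B r) = dim (Eig r)" "\<And>r. span (B r) = Eig r"
    by metis
  have eigB: "A *v b = r *\<^sub>R b" if "b \<in> B r" for b r
    using B(1) that by (auto simp: Eig_def)
  define U where "U = (\<Union>r\<in>R. B r)"
  define N where "N = span U"
  have orthU: "pairwise orthogonal U"
    unfolding pairwise_def U_def
  proof (clarify)
    fix x y r s assume *: "x \<in> B r" "y \<in> B s" "x \<noteq> y"
    show "orthogonal x y"
    proof (cases "r = s")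
      case True
      then show ?thesis using B(2)[of r] * by (auto simp: pairwise_def)
    next
      case False
      then show ?thesis
        using eigenvectors_orthogonal[OF sym eigB[OF *(1)] eigB[OF *(2)]] by (simp add: orthogonal_def)
    qed
  qed
  have "0 \<notin> U" using B(3) by (force simp: U_def)
  then have indU: "independent U"
    using orthU pairwise_orthogonal_independent by blast
  then have finU: "finite U" by (rule independent_imp_finite)
  have disj: "B r \<inter> B s = {}" if "r \<noteq> s" for r s
  proof -
    have False if "b \<in> B r" "b \<in> B s" for b
      using eigB[OF that(1)] eigB[OF that(2)] B(3)[OF that(1)] \<open>r \<noteq> s\<close> by auto
    then show ?thesis by blast
  qed
  have nonempty: "B r \<noteq> {}" if "r \<in> R" for r
  proof
    assume "B r = {}"
    then have "Eig r = {0}" using B(6)[of r] by simp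
    then show False using that by (auto simp: R_def Eig_def)
  qed
  have "inj_on (\<lambda>r. SOME b. b \<in> B r) R"
    using disj nonempty by (intro inj_onI) (metis disjoint_iff some_in_eq)
  moreover have "(\<lambda>r. SOME b. b \<in> B r) ` R \<subseteq> U"
    using nonempty some_in_eq by (fastforce simp: U_def)
  ultimately have finR: "finite R"
    using finU by (meson finite_imageD finite_subset)
  have "dim N = card U"
    unfolding N_def using dim_eq_card_independent[OF indU] by simp
  also have "\<dots> = (\<Sum>r\<in>R. card (B r))"
    unfolding U_def using finR disj independent_imp_finite[OF B(4)]
    by (intro card_UN_disjoint) auto
  also have "\<dots> = ind A"
    unfolding ind_def using B(5) by (simp add: R_def Eig_def)
  finally have dimN: "dim N = ind A" .
  have subN: "subspace N" unfolding N_def by simp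
  have EigN: "Eig r \<subseteq> N" if "r \<in> R" for r
    using B(6)[of r] that unfolding N_def U_def by (metis UN_upper span_mono)
  have rangeN: "\<exists>u\<in>N. v = A *v u" and invN: "A *v v \<in> N" if "v \<in> N" for v
  proof -
    have "v \<in> span U" using that by (simp add: N_def)
    then have "(\<exists>u\<in>N. v = A *v u) \<and> A *v v \<in> N"
    proof (induction rule: span_induct_alt)
      case base
      show ?case using subN by (auto simp: subspace_0 intro: bexI[of _ 0])
    next
      case (step c b y)
      then obtain r u where r: "r \<in> R" "b \<in> B r" and u: "u \<in> N" "y = A *v u" and y: "A *v y \<in> N"
        by (auto simp: U_def)
      have bN: "b \<in> N" using r B(1) EigN by blast
      have "r \<noteq> 0" using r by (simp add: R_def)
      then have "c *\<^sub>R b + y = A *v ((c / r) *\<^sub>R b + u)"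
        using u eigB[OF r(2)] by (simp add: matrix_vector_right_distrib matrix_vector_mult_scaleR)
      moreover have "(c / r) *\<^sub>R b + u \<in> N" using subN bN u by (simp add: subspace_add subspace_scale)
      moreover have "A *v (c *\<^sub>R b + y) \<in> N"
        using subN bN y eigB[OF r(2)]
        by (simp add: matrix_vector_right_distrib matrix_vector_mult_scaleR subspace_add subspace_scale)
      ultimately show ?case by blast
    qed
    then show "\<exists>u\<in>N. v = A *v u" "A *v v \<in> N" by auto
  qed
  let ?P = "{v. \<forall>w\<in>N. w \<bullet> v = 0}"
  have neg: "v \<bullet> (A *v v) < 0" if v: "v \<in> N" "v \<noteq> 0" for v
  proof -
    obtain u c where u: "u \<in> N" "norm u = 1" "(- A) *v u = c *\<^sub>R u"
        and low: "\<And>w. w \<in> N \<Longrightarrow> c * (w \<bullet> w) \<le> w \<bullet> ((- A) *v w)"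
      using rayleigh_minimum_eigenvector[OF symmetric_mat_uminus[OF sym] subN, of thesis] v invN subN
      by (force simp: uminus_matrix_vector subspace_neg)
    have eig: "A *v u = (- c) *\<^sub>R u" using u(3) by (simp add: uminus_matrix_vector) (metis add.inverse_inverse)
    have "c > 0"
    proof (rule ccontr)
      assume "\<not> c > 0"
      then have "b \<bullet> u = 0" if "b \<in> U" for b
        using that eigB eigenvectors_orthogonal[OF sym _ eig] by (force simp: U_def R_def)
      then have "N \<subseteq> {w. w \<bullet> u = 0}"
        unfolding N_def by (intro span_minimal) (auto simp: subspace_def inner_add_left)
      then have "u \<bullet> u = 0" using u(1) by blast
      then show False using u(2) by simp
    qed
    then have "0 < c * (v \<bullet> v)" using v by simp
    then show ?thesis using low[OF v(1)] by (simp add: uminus_matrix_vector)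
  qed
  have orth: "w \<bullet> (A *v v) = 0" if "w \<in> N" "\<And>w. w \<in> N \<Longrightarrow> w \<bullet> v = 0" for v w
    using symmetric_mat_inner[OF sym, of w v] invN[OF that(1)] that(2) by simp
  have nonneg: "0 \<le> v \<bullet> (A *v v)" if v: "\<And>w. w \<in> N \<Longrightarrow> w \<bullet> v = 0" for v
  proof (cases "v = 0")
    case False
    have "v \<in> ?P" using v by simp
    then have "?P \<noteq> {0}" using False by blast
    then obtain u c where u: "u \<in> ?P" "norm u = 1" "A *v u = c *\<^sub>R u"
        and low: "\<And>w. w \<in> ?P \<Longrightarrow> c * (w \<bullet> w) \<le> w \<bullet> (A *v w)"
      using rayleigh_minimum_eigenvector[OF sym subspace_orthogonal_complement[of N], of thesis] orth
      by auto
    have "c \<ge> 0"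
    proof (rule ccontr)
      assume "\<not> c \<ge> 0"
      then have "c \<in> R" using u by (auto simp: R_def intro!: exI[of _ u])
      then have "u \<in> N" using EigN[of c] u(3) by (auto simp: Eig_def)
      then have "u \<bullet> u = 0" using u(1) by blast
      then show False using u(2) by simp
    qed
    then have "0 \<le> c * (v \<bullet> v)" by simp
    then show ?thesis using low[of v] v by auto
  qed simp
  show thesis
    using that[OF subN dimN neg nonneg orth] rangeN by blast
qed

text \<open>Sylvester's law of inertia in the form used below: a subspace on which the form is negative definite
  meets the orthogonal complement of \<open>N\<close> from \<open>ind_decomposition\<close>, where the form is nonnegative, only
  in \<open>0\<close>.\<close>

lemma dim_le_ind_if_negative_definite:
  fixes A :: "real^'n::finite^'n"
  assumes "symmetric_mat A" "subspace H" "\<And>v. v \<in> H \<Longrightarrow> v \<noteq> 0 \<Longrightarrow> v \<bullet> (A *v v) < 0"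
  shows "dim H \<le> ind A"
proof -
  obtain N where N: "subspace N" "dim N = ind A"
    "\<And>v. (\<And>w. w \<in> N \<Longrightarrow> w \<bullet> v = 0) \<Longrightarrow> 0 \<le> v \<bullet> (A *v v)"
    using ind_decomposition[OF assms(1)] by metis
  have "dim H + dim {v. \<forall>w\<in>N. w \<bullet> v = 0} \<le> DIM(real^'n)"
    using assms(3) N(3) by (intro dim_add_le_if_trivial_Int assms subspace_orthogonal_complement) force
  then show ?thesis
    using dim_orthogonal_complement[OF N(1)] N(2) by linarith
qed

lemma dim_kernel_plus_rank:
  fixes A :: "real^'n::finite^'m::finite"
  shows "dim {v. A *v v = 0} + rank A = CARD('n)"
proof -
  have "{v. A *v v = 0} = {v. \<forall>w\<in>span (rows A). w \<bullet> v = 0}" 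
  proof -
    have "A *v v = 0 \<longleftrightarrow> (\<forall>w\<in>span (rows A). w \<bullet> v = 0)" for v
    proof
      assume "A *v v = 0"
      then have "row i A \<bullet> v = 0" for i
        by (simp add: matrix_mult_dot vec_eq_iff row_def vec_lambda_eta)
      then have "span (rows A) \<subseteq> {w. w \<bullet> v = 0}"
        by (intro span_minimal) (auto simp: subspace_def inner_add_left rows_def)
      then show "\<forall>w\<in>span (rows A). w \<bullet> v = 0" by blast
    next
      assume "\<forall>w\<in>span (rows A). w \<bullet> v = 0"
      then have "row i A \<bullet> v = 0" for i by (auto simp: rows_def intro: span_base)
      then show "A *v v = 0" by (simp add: matrix_mult_dot vec_eq_iff row_def vec_lambda_eta)
    qed
    then show ?thesis by blast
  qed
  then show ?thesis
    using dim_orthogonal_complement[OF subspace_span[of "rows A"]] by (simp add: row_rank_def)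
qed

text \<open>The negative spaces of \<open>A\<close> and \<open>- A\<close> lie in the range of \<open>A\<close> and meet trivially, and a vector
  orthogonal to both is in the kernel, because the form is at once nonnegative and nonpositive there.\<close>

lemma rank_eq_ind_plus_ind_uminus:
  fixes A :: "real^'n::finite^'n"
  assumes sym: "symmetric_mat A"
  shows "rank A = ind A + ind (- A)"
proof -
  obtain N where N: "subspace N" "dim N = ind A"
    "\<And>v. v \<in> N \<Longrightarrow> v \<noteq> 0 \<Longrightarrow> v \<bullet> (A *v v) < 0"
    "\<And>v. (\<And>w. w \<in> N \<Longrightarrow> w \<bullet> v = 0) \<Longrightarrow> 0 \<le> v \<bullet> (A *v v)"
    "\<And>v w. w \<in> N \<Longrightarrow> (\<And>w. w \<in> N \<Longrightarrow> w \<bullet> v = 0) \<Longrightarrow> w \<bullet> (A *v v) = 0"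
    "N \<subseteq> range ((*v) A)"
    using ind_decomposition[OF sym] by metis
  obtain M where M: "subspace M" "dim M = ind (- A)"
    "\<And>v. v \<in> M \<Longrightarrow> v \<noteq> 0 \<Longrightarrow> v \<bullet> ((- A) *v v) < 0"
    "\<And>v. (\<And>w. w \<in> M \<Longrightarrow> w \<bullet> v = 0) \<Longrightarrow> 0 \<le> v \<bullet> ((- A) *v v)"
    "\<And>v w. w \<in> M \<Longrightarrow> (\<And>w. w \<in> M \<Longrightarrow> w \<bullet> v = 0) \<Longrightarrow> w \<bullet> ((- A) *v v) = 0"
    "M \<subseteq> range ((*v) (- A))"
    using ind_decomposition[OF symmetric_mat_uminus[OF sym]] by metis
  let ?S = "{x + y |x y. x \<in> N \<and> y \<in> M}"
  have "N \<inter> M = {0}"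
    using N(1,3) M(1,3) subspace_0 by (force simp: uminus_matrix_vector)
  then have dimS: "dim ?S = ind A + ind (- A)"
    using dim_sums_Int[OF N(1) M(1)] N(2) M(2) by simp
  have subS: "subspace ?S" using N(1) M(1) by (rule subspace_sums)
  have "?S \<subseteq> range ((*v) A)"
  proof clarify
    fix x y assume "x \<in> N" "y \<in> M"
    obtain x' where "x = A *v x'" using N(6) \<open>x \<in> N\<close> by blast
    moreover obtain y' where "y = (- A) *v y'" using M(6) \<open>y \<in> M\<close> by blast
    ultimately have "x + y = A *v (x' - y')"
      by (simp add: matrix_vector_mult_diff_distrib uminus_matrix_vector)
    then show "x + y \<in> range ((*v) A)" by blast
  qed
  then have "dim ?S \<le> rank A" unfolding rank_dim_range by (rule dim_subset)
  moreover have "{v. \<forall>w\<in>?S. w \<bullet> v = 0} \<subseteq> {v. A *v v = 0}"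
  proof clarify
    fix v assume v: "\<forall>w\<in>?S. w \<bullet> v = 0"
    have vN: "w \<bullet> v = 0" if "w \<in> N" for w
      using v that M(1) subspace_0[of M] by (metis (mono_tags, lifting) add.right_neutral mem_Collect_eq)
    have vM: "w \<bullet> v = 0" if "w \<in> M" for w
      using v that N(1) subspace_0[of N] by (metis (mono_tags, lifting) add.left_neutral mem_Collect_eq)
    have form0: "u \<bullet> (A *v u) = 0" if "\<And>w. w \<in> N \<Longrightarrow> w \<bullet> u = 0" "\<And>w. w \<in> M \<Longrightarrow> w \<bullet> u = 0" for u
      using N(4)[of u] M(4)[of u] that by (force simp: uminus_matrix_vector)
    define u where "u = A *v v"
    have uN: "w \<bullet> u = 0" if "w \<in> N" for w using N(5)[OF that vN] by (simp add: u_def)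
    have uM: "w \<bullet> u = 0" if "w \<in> M" for w using M(5)[OF that vM] by (simp add: u_def uminus_matrix_vector)
    \<comment> \<open>The form vanishes on the common orthogonal complement, which contains both \<open>v\<close> and
      \<open>u = A v\<close>; polarization gives \<open>u \<bullet> u = 0\<close>.\<close>
    have "(u + v) \<bullet> (A *v (u + v)) = 0"
      using uN uM vN vM by (intro form0) (auto simp: inner_add_right)
    then have "u \<bullet> u = 0"
      using form0[OF uN uM] form0[OF vN vM] symmetric_mat_inner[OF sym, of v u]
      by (simp add: inner_add_left inner_add_right matrix_vector_right_distrib u_def[symmetric] inner_commute)
    then show "A *v v = 0" by (simp add: u_def)
  qed
  then have "dim {v. \<forall>w\<in>?S. w \<bullet> v = 0} \<le> dim {v. A *v v = 0}" by (rule dim_subset)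
  ultimately show ?thesis
    using dim_orthogonal_complement[OF subS] dim_kernel_plus_rank[of A] dimS by simp
qed

section \<open>The Moore-Penrose inverse\<close>

(* The adjoint rule inner_matrix_vector_transpose needs products with a transpose to stay in this form. *)
declare transpose_matrix_vector [simp del]

lemma symmetric_mat_iff_inner:
  fixes A :: "real^'n::finite^'n"
  shows "symmetric_mat A \<longleftrightarrow> (\<forall>v w. v \<bullet> (A *v w) = (A *v v) \<bullet> w)"
proof
  assume *: "\<forall>v w. v \<bullet> (A *v w) = (A *v v) \<bullet> w"
  have "(transpose A *v v) \<bullet> w = (A *v v) \<bullet> w" for v w
    using * inner_matrix_vector_transpose by metis
  then have "transpose A *v v = A *v v" for v
    using vector_eq_rdot by blast
  then show "symmetric_mat A"
    unfolding symmetric_mat_def by (simp add: matrix_eq)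
qed (simp add: symmetric_mat_inner)

lemma orthogonal_projection_matrix:
  fixes S :: "(real^'n::finite) set"
  assumes "subspace S"
  obtains p :: "real^'n^'n" where "symmetric_mat p" "\<And>x. p *v x \<in> S" "\<And>x. x \<in> S \<Longrightarrow> p *v x = x"
proof -
  obtain B where B: "B \<subseteq> S" "pairwise orthogonal B" "\<And>x. x \<in> B \<Longrightarrow> norm x = 1"
      "independent B" "span B = S"
    using orthonormal_basis_subspace[OF assms] by metis
  have fin: "finite B" using B(4) by (rule independent_imp_finite)
  define f where "f = (\<lambda>x. \<Sum>b\<in>B. (b \<bullet> x) *\<^sub>R b)"
  have lin: "linear f"
    unfolding f_def
    by (rule linearI) (simp_all add: inner_add_right scaleR_add_left sum.distrib scaleR_sum_right)
  define p where "p = matrix f"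
  have p: "p *v x = f x" for x unfolding p_def using lin by (simp add: matrix_works)
  have fS: "f x \<in> S" for x
    unfolding f_def using B(1) assms by (intro subspace_sum subspace_scale) auto
  have inner_f: "v \<bullet> f w = (\<Sum>b\<in>B. (b \<bullet> v) * (b \<bullet> w))" for v w
    unfolding f_def by (simp add: inner_sum_right inner_commute mult.commute)
  have "f x = x" if "x \<in> S" for x
  proof -
    have "b \<bullet> (x - f x) = 0" if "b \<in> B" for b
    proof -
      have "(\<Sum>c\<in>B. (c \<bullet> b) * (c \<bullet> x)) = (\<Sum>c\<in>{b}. (c \<bullet> b) * (c \<bullet> x))"
        using B(2) that fin
        by (intro sum.mono_neutral_right) (auto simp: pairwise_def orthogonal_def)
      also have "\<dots> = b \<bullet> x" using B(3)[OF that] by (simp add: dot_square_norm)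
      finally show ?thesis by (simp add: inner_diff_right inner_f)
    qed
    then have "span B \<subseteq> {v. v \<bullet> (x - f x) = 0}"
      by (intro span_minimal) (auto simp: subspace_def inner_add_left)
    moreover have "x - f x \<in> span B" using that fS B(5) assms by (simp add: subspace_diff)
    ultimately have "(x - f x) \<bullet> (x - f x) = 0" by blast
    then show ?thesis by simp
  qed
  moreover have "symmetric_mat p"
    unfolding symmetric_mat_iff_inner p using inner_f by (simp add: inner_commute mult.commute)
  ultimately show thesis using that[of p] fS p by simp
qed

text \<open>The inverse of \<open>A\<close> from the orthogonal complement of its kernel onto its range, composed with the
  orthogonal projection \<open>Q\<close> onto the range. With \<open>K\<close> the projection onto the kernel this gives
  \<open>G A = 1 - K\<close> and \<open>A G = Q\<close>, from which the four Penrose equations can be read off.\<close>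

lemma is_pinv_exists:
  fixes A :: "real^'n::finite^'m::finite"
  shows "\<exists>G. is_pinv A G"
proof -
  have "subspace {x. A *v x = 0}"
    by (auto simp: subspace_def matrix_vector_right_distrib matrix_vector_mult_scaleR)
  from orthogonal_projection_matrix[OF this]
  obtain K :: "real^'n^'n" where "symmetric_mat K" "\<And>x. K *v x \<in> {x. A *v x = 0}"
      "\<And>x. x \<in> {x. A *v x = 0} \<Longrightarrow> K *v x = x"
    by blast
  then have K: "symmetric_mat K" "\<And>x. A *v (K *v x) = 0" "\<And>x. A *v x = 0 \<Longrightarrow> K *v x = x"
    by auto
  have "subspace (range ((*v) A))"
    using matrix_vector_mul_linear subspace_UNIV by (rule linear_subspace_image)
  from orthogonal_projection_matrix[OF this]
  obtain Q :: "real^'m^'m" where Q: "symmetric_mat Q" "\<And>y. Q *v y \<in> range ((*v) A)"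
      and "\<And>y. y \<in> range ((*v) A) \<Longrightarrow> Q *v y = y"
    by blast
  then have QA: "Q *v (A *v x) = A *v x" for x by blast
  define V where "V = {x. K *v x = 0}"
  have V: "subspace V"
    unfolding V_def by (auto simp: subspace_def matrix_vector_right_distrib matrix_vector_mult_scaleR)
  have "inj_on ((*v) A) V"
  proof (rule inj_onI)
    fix x y assume *: "x \<in> V" "y \<in> V" "A *v x = A *v y"
    then have "K *v (x - y) = x - y" by (intro K(3)) (simp add: matrix_vector_mult_diff_distrib)
    moreover have "K *v (x - y) = 0" using * V subspace_diff V_def by blast
    ultimately show "x = y" by simp
  qed
  then obtain g where g: "range g \<subseteq> V" "linear g" "\<And>v. v \<in> V \<Longrightarrow> g (A *v v) = v"
    using linear_exists_left_inverse_on[OF matrix_vector_mul_linear V] by metis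
  define G where "G = matrix g ** Q"
  have G: "G *v y = g (Q *v y)" for y
    unfolding G_def using g(2) by (simp add: matrix_works flip: matrix_vector_mul_assoc)
  have KK: "K *v (K *v x) = K *v x" for x by (rule K(3)) (rule K(2))
  have GA: "G *v (A *v x) = x - K *v x" for x
  proof -
    have "x - K *v x \<in> V" unfolding V_def by (simp add: matrix_vector_mult_diff_distrib KK)
    from g(3)[OF this] show ?thesis by (simp add: G QA matrix_vector_mult_diff_distrib K(2))
  qed
  have AG: "A *v (G *v y) = Q *v y" for y
  proof -
    obtain x where x: "Q *v y = A *v x" using Q(2) by blast
    have "A *v (G *v y) = A *v (G *v (A *v x))" by (simp add: G QA x)
    then show ?thesis using x by (simp add: GA matrix_vector_mult_diff_distrib K(2))
  qed
  have KG: "K *v (G *v y) = 0" for y using g(1) by (auto simp: G V_def)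
  have "A ** G ** A = A"
    by (simp add: matrix_eq AG QA flip: matrix_vector_mul_assoc)
  moreover have "G ** A ** G = G"
    by (simp add: matrix_eq GA KG flip: matrix_vector_mul_assoc)
  moreover have "symmetric_mat (A ** G)"
    using Q(1) by (simp add: symmetric_mat_iff_inner AG flip: matrix_vector_mul_assoc)
  moreover have "symmetric_mat (G ** A)"
    using K(1) by (simp add: symmetric_mat_iff_inner GA inner_diff_left inner_diff_right
        flip: matrix_vector_mul_assoc)
  ultimately show ?thesis unfolding is_pinv_def by blast
qed

lemma is_pinv_unique:
  fixes A :: "real^'n::finite^'m::finite"
  assumes "is_pinv A G" "is_pinv A H"
  shows "G = H"
proof -
  have 1: "A ** G = A ** H"
  proof -
    have "A ** G = (A ** H) ** (A ** G)"
      using assms by (simp add: is_pinv_def matrix_mul_assoc)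
    also have "\<dots> = transpose ((A ** G) ** (A ** H))"
      using assms by (simp add: is_pinv_def symmetric_mat_def matrix_transpose_mul)
    also have "(A ** G) ** (A ** H) = A ** H"
      using assms by (simp add: is_pinv_def matrix_mul_assoc)
    finally show ?thesis using assms by (simp add: is_pinv_def symmetric_mat_def)
  qed
  have 2: "G ** A = H ** A"
  proof -
    have "G ** A = (G ** A) ** (H ** A)"
      using assms by (simp add: is_pinv_def flip: matrix_mul_assoc)
    also have "\<dots> = transpose ((H ** A) ** (G ** A))"
      using assms by (simp add: is_pinv_def symmetric_mat_def matrix_transpose_mul)
    also have "(H ** A) ** (G ** A) = H ** A"
      using assms by (simp add: is_pinv_def flip: matrix_mul_assoc)
    finally show ?thesis using assms by (simp add: is_pinv_def symmetric_mat_def)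
  qed
  have "G = G ** A ** G" using assms by (simp add: is_pinv_def)
  also have "\<dots> = H ** (A ** G)" by (simp add: 2 matrix_mul_assoc)
  also have "\<dots> = H ** A ** H" by (simp add: 1 matrix_mul_assoc)
  also have "\<dots> = H" using assms by (simp add: is_pinv_def)
  finally show ?thesis .
qed

lemma is_pinv_pinv: "is_pinv A (pinv A)"
  unfolding pinv_def using is_pinv_exists is_pinv_unique by (metis theI')

section \<open>The comparative index of two graphs\<close>

text \<open>The hypotheses say that, up to a shear, the two subspaces are the graphs of \<open>P\<close> and \<open>R\<close> with
  \<open>A\<close> and \<open>B\<close> as changes of basis. For \<open>t\<close> in the kernel of \<open>\<M>\<close> put \<open>u = B t\<close> and let \<open>z\<close> be a
  solution of \<open>P z = R u\<close>. The form \<open>\<D>\<close> is \<open>u \<bullet> R u - z \<bullet> P z\<close>, the generalized Schur complement of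
  \<open>P\<close> in the form \<open>q (x, x + u) = x \<bullet> P x + 2 (x \<bullet> R u) + u \<bullet> R u\<close>, while each dimension of the range
  of \<open>\<M>\<close> contributes one hyperbolic plane, hence one negative direction. On the other hand
  \<open>q (x, y) = x \<bullet> (P - R) x + y \<bullet> R y\<close>. Each of the two descriptions yields a subspace where \<open>q\<close> is
  negative definite and a subspace of complementary dimension where \<open>q\<close> is nonnegative; comparing them
  crosswise shows that the two negative dimensions agree.\<close>

lemma comparative_index_of_graphs:
  fixes P R A B :: "real^'n::finite^'n" and Y Y' :: "real^'n^('n + 'n)"
  assumes symP: "symmetric_mat P" and symR: "symmetric_mat R"
    and invA: "invertible A" and invB: "invertible B"
    and X: "upper_block Y = P ** A" and X': "upper_block Y' = R ** B"
    and w: "wronskian Y Y' = transpose A ** (P - R) ** B"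
  shows "comparative_index Y Y' + ind P = ind (P - R) + ind R"
proof -
  define X where "X = P ** A"
  define X' where "X' = R ** B"
  define G where "G = pinv X"
  define M where "M = (mat 1 - X ** G) ** X'"
  define Md where "Md = pinv M"
  define T where "T = mat 1 - Md ** M"
  define w where "w = wronskian Y Y'"
  define D where "D = T ** transpose w ** G ** X' ** T"
  have ci: "comparative_index Y Y' = rank M + ind D"
    unfolding comparative_index_def Let_def D_def T_def Md_def M_def G_def X_def X'_def w_def
    by (simp add: assms(5,6))
  have pG: "is_pinv X G" and pM: "is_pinv M Md" unfolding G_def Md_def by (rule is_pinv_pinv)+
  have XGX: "X *v (G *v (X *v v)) = X *v v" for v
    using pG by (simp add: is_pinv_def matrix_vector_mul_assoc matrix_mul_assoc)
  have symXG: "x \<bullet> (X *v (G *v y)) = (X *v (G *v x)) \<bullet> y" for x y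
    using pG symmetric_mat_inner[of "X ** G"] by (simp add: is_pinv_def matrix_vector_mul_assoc)
  have MMdM: "M *v (Md *v (M *v v)) = M *v v" for v
    using pM by (simp add: is_pinv_def matrix_vector_mul_assoc matrix_mul_assoc)
  have symMdM: "x \<bullet> (Md *v (M *v y)) = (Md *v (M *v x)) \<bullet> y" for x y
    using pM symmetric_mat_inner[of "Md ** M"] by (simp add: is_pinv_def matrix_vector_mul_assoc)
  have Mv: "M *v v = X' *v v - X *v (G *v (X' *v v))" for v
    unfolding M_def by (simp add: matrix_vector_mult_diff_rdistrib flip: matrix_vector_mul_assoc)
  have Tv: "T *v v = v - Md *v (M *v v)" for v
    unfolding T_def by (simp add: matrix_vector_mult_diff_rdistrib flip: matrix_vector_mul_assoc)
  \<comment> \<open>\<open>T\<close> is the orthogonal projection onto the kernel of \<open>M\<close>.\<close>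
  have MT: "M *v (T *v v) = 0" for v by (simp add: Tv matrix_vector_mult_diff_distrib MMdM)
  have Tker: "T *v t = t" if "M *v t = 0" for t using that by (simp add: Tv)
  have symT: "x \<bullet> (T *v y) = (T *v x) \<bullet> y" for x y
    by (simp add: Tv inner_diff_left inner_diff_right symMdM)
  have sP: "x \<bullet> (P *v y) = (P *v x) \<bullet> y" for x y by (rule symmetric_mat_inner[OF symP])
  have sR: "x \<bullet> (R *v y) = (R *v x) \<bullet> y" for x y by (rule symmetric_mat_inner[OF symR])
  have Xv: "X *v v = P *v (A *v v)" and X'v: "X' *v v = R *v (B *v v)" for v
    by (simp_all add: X_def X'_def matrix_vector_mul_assoc)

  \<comment> \<open>The linear choice of \<open>z\<close> with \<open>P z = R (B t)\<close>.\<close>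
  define Z where "Z = A ** G ** X'"
  have Zv: "Z *v t = A *v (G *v (X' *v t))" for t by (simp add: Z_def flip: matrix_vector_mul_assoc)
  have PZ: "P *v (Z *v t) = R *v (B *v t)" if "M *v t = 0" for t
    using that by (simp add: Zv Mv Xv X'v)
  have inner_D: "v' \<bullet> (D *v v) = (B *v (T *v v')) \<bullet> (R *v (B *v (T *v v)))
       - (Z *v (T *v v')) \<bullet> (P *v (Z *v (T *v v)))" for v v'
  proof -
    define t where "t = T *v v"
    define t' where "t' = T *v v'"
    have "v' \<bullet> (D *v v) = t' \<bullet> (transpose w *v (G *v (X' *v t)))"
      unfolding D_def t_def t'_def by (simp add: symT flip: matrix_vector_mul_assoc)
    also have "\<dots> = (w *v t') \<bullet> (G *v (X' *v t))"
      using inner_matrix_vector_transpose[of t' "transpose w"] by simp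
    also have "w *v t' = transpose A *v ((P - R) *v (B *v t'))"
      by (simp add: w_def assms(7) matrix_vector_mul_assoc matrix_mul_assoc)
    also have "\<dots> \<bullet> (G *v (X' *v t)) = ((P - R) *v (B *v t')) \<bullet> (Z *v t)"
      using inner_matrix_vector_transpose[of "(P - R) *v (B *v t')" A] by (simp add: Zv)
    also have "\<dots> = (B *v t') \<bullet> (R *v (B *v t)) - (Z *v t') \<bullet> (P *v (Z *v t))"
      using PZ[OF MT, of v] PZ[OF MT, of v'] sP[of "B *v t'" "Z *v t"] sP[of "Z *v t'" "Z *v t"]
      unfolding t_def[symmetric] t'_def[symmetric]
      by (simp add: matrix_vector_mult_diff_rdistrib inner_diff_left)
    finally show ?thesis unfolding t_def t'_def .
  qed
  have symD: "symmetric_mat D"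
    unfolding symmetric_mat_iff_inner
  proof (intro allI)
    fix v w
    show "v \<bullet> (D *v w) = (D *v v) \<bullet> w"
      unfolding inner_commute[of "D *v v" w] inner_D
      using sP[of "Z *v (T *v v)" "Z *v (T *v w)"] sR[of "B *v (T *v v)" "B *v (T *v w)"]
      by (simp add: inner_commute)
  qed
  have symPR: "symmetric_mat (P - R)"
    unfolding symmetric_mat_iff_inner
    by (simp add: sP sR matrix_vector_mult_diff_rdistrib inner_diff_left inner_diff_right)

  obtain NP where NP: "subspace NP" "dim NP = ind P"
    "\<And>v. v \<in> NP \<Longrightarrow> v \<noteq> 0 \<Longrightarrow> v \<bullet> (P *v v) < 0"
    "\<And>v. (\<And>w. w \<in> NP \<Longrightarrow> w \<bullet> v = 0) \<Longrightarrow> 0 \<le> v \<bullet> (P *v v)"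
    using ind_decomposition[OF symP] by metis
  obtain NR where NR: "subspace NR" "dim NR = ind R"
    "\<And>v. v \<in> NR \<Longrightarrow> v \<noteq> 0 \<Longrightarrow> v \<bullet> (R *v v) < 0"
    "\<And>v. (\<And>w. w \<in> NR \<Longrightarrow> w \<bullet> v = 0) \<Longrightarrow> 0 \<le> v \<bullet> (R *v v)"
    using ind_decomposition[OF symR] by metis
  obtain NS where NS: "subspace NS" "dim NS = ind (P - R)"
    "\<And>v. v \<in> NS \<Longrightarrow> v \<noteq> 0 \<Longrightarrow> v \<bullet> ((P - R) *v v) < 0"
    "\<And>v. (\<And>w. w \<in> NS \<Longrightarrow> w \<bullet> v = 0) \<Longrightarrow> 0 \<le> v \<bullet> ((P - R) *v v)"
    using ind_decomposition[OF symPR] by metis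
  obtain ND where ND: "subspace ND" "dim ND = ind D"
    "\<And>v. v \<in> ND \<Longrightarrow> v \<noteq> 0 \<Longrightarrow> v \<bullet> (D *v v) < 0"
    "\<And>v. (\<And>w. w \<in> ND \<Longrightarrow> w \<bullet> v = 0) \<Longrightarrow> 0 \<le> v \<bullet> (D *v v)"
    "ND \<subseteq> range ((*v) D)"
    using ind_decomposition[OF symD] by metis
  define C where "C = {t. M *v t = 0}"
  have subC: "subspace C"
    unfolding C_def by (auto simp: subspace_def matrix_vector_right_distrib matrix_vector_mult_scaleR)
  have NDC: "ND \<subseteq> C"
  proof
    fix t assume "t \<in> ND"
    then obtain v where "t = D *v v" using ND(5) by blast
    then have "t = T *v (transpose w *v (G *v (X' *v (T *v v))))"
      unfolding D_def by (simp flip: matrix_vector_mul_assoc)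
    then show "t \<in> C" using MT by (simp add: C_def)
  qed
  let ?orth = "\<lambda>S. {v. \<forall>w\<in>S. w \<bullet> v = 0}"
  define C' where "C' = ?orth C"
  have subC': "subspace C'" unfolding C'_def by (rule subspace_orthogonal_complement)
  have MdM: "Md *v (M *v m) = m" if "m \<in> C'" for m
  proof -
    have "T *v (T *v m) = T *v m" using Tker MT by blast
    moreover have "(T *v m) \<bullet> m = 0" using that MT by (simp add: C'_def C_def)
    ultimately have "(T *v m) \<bullet> (T *v m) = 0" by (simp add: symT)
    then show ?thesis by (simp add: Tv)
  qed

  define q where "q = (\<lambda>(x, y). x \<bullet> ((P - R) *v x) + y \<bullet> (R *v y))"
  have q_shift: "q (x, x + u) = x \<bullet> (P *v x) + 2 * (x \<bullet> (R *v u)) + u \<bullet> (R *v u)" for x u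
    unfolding q_def using sR[of u x] inner_commute[of "R *v u" x]
    by (simp add: matrix_vector_mult_diff_rdistrib matrix_vector_right_distrib inner_diff_right
        inner_add_left inner_add_right)

  \<comment> \<open>Pairing \<open>kk *v \<phi>\<close> with \<open>R (B m)\<close> for \<open>m\<close> orthogonal to the kernel of \<open>M\<close> gives \<open>\<phi> \<bullet> m\<close>, and \<open>kk *v \<phi>\<close>
    is in the kernel of \<open>P\<close>: it can be added to \<open>x\<close> in order to prescribe the mixed terms with \<open>m\<close>.\<close>
  define kk where "kk = (mat 1 - X ** G) ** transpose Md"
  have kkv: "kk *v \<phi> = transpose Md *v \<phi> - X *v (G *v (transpose Md *v \<phi>))" for \<phi>
    unfolding kk_def by (simp add: matrix_vector_mult_diff_rdistrib flip: matrix_vector_mul_assoc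
       )
  have inner_kk: "(kk *v \<phi>) \<bullet> v = \<phi> \<bullet> (Md *v (v - X *v (G *v v)))" for \<phi> v
    unfolding inner_matrix_vector_transpose[of _ Md] kkv
    by (simp add: inner_diff_left inner_diff_right symXG)
  have Pkk: "P *v (kk *v \<phi>) = 0" for \<phi>
  proof -
    obtain A' where "A ** A' = mat 1" using invA by (auto simp: invertible_def)
    then have AA': "A *v (A' *v x) = x" for x by (simp add: matrix_vector_mul_assoc)
    have "x \<bullet> (P *v (kk *v \<phi>)) = 0" for x
    proof -
      have "x \<bullet> (P *v (kk *v \<phi>)) = (kk *v \<phi>) \<bullet> (X *v (A' *v x))"
        by (simp add: Xv AA' sP[of x] inner_commute[of "P *v x"])
      then show ?thesis unfolding inner_kk by (simp add: XGX)
    qed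
    from this[of "P *v (kk *v \<phi>)"] show ?thesis by simp
  qed
  have kkX': "(kk *v \<phi>) \<bullet> (R *v (B *v v)) = \<phi> \<bullet> (Md *v (M *v v))" for \<phi> v
    unfolding inner_kk Mv X'v ..

  \<comment> \<open>\<open>ph\<close> is the value of \<open>\<phi>\<close> that cancels all terms of \<open>q\<close> involving \<open>m\<close> and leaves \<open>- (m \<bullet> m)\<close>.\<close>
  define ph where "ph = (\<lambda>(p, t, m). - (1 / 2) *\<^sub>R m
      - transpose X' *v (p - Z *v t + B *v t + (1 / 2) *\<^sub>R (B *v m)))"
  define f where "f = (\<lambda>(p, t, m). (p + kk *v ph (p, t, m) - Z *v t,
      (p + kk *v ph (p, t, m) - Z *v t) + B *v (t + m)))"
  have "linear f"
    unfolding f_def ph_def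
    by (rule linearI)
      (auto simp: matrix_vector_right_distrib matrix_vector_mult_diff_distrib
        matrix_vector_mult_scaleR algebra_simps scaleR_add_right scaleR_diff_right)
  have qf: "q (f (p, t, m)) = p \<bullet> (P *v p) + t \<bullet> (D *v t) - m \<bullet> m"
    if t: "t \<in> C" and m: "m \<in> C'" for p t m
  proof -
    define k where "k = kk *v ph (p, t, m)"
    define z where "z = Z *v t"
    define b where "b = B *v t"
    define c where "c = B *v m"
    have Mt: "M *v t = 0" using t by (simp add: C_def)
    have 1: "P *v k = 0" unfolding k_def by (rule Pkk)
    have 2: "P *v z = R *v b" unfolding z_def b_def using PZ Mt by blast
    have 3: "k \<bullet> (R *v b) = 0" unfolding k_def b_def kkX' Mt by simp
    have "k \<bullet> (R *v c) = ph (p, t, m) \<bullet> m" unfolding k_def c_def kkX' MdM[OF m] ..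
    also have "\<dots> = - (1 / 2) * (m \<bullet> m) - (p - z + b + (1 / 2) *\<^sub>R c) \<bullet> (R *v c)"
      unfolding ph_def c_def b_def z_def X'v[symmetric] inner_matrix_vector_transpose[of _ X']
      by (simp add: inner_diff_left)
    finally have 4: "k \<bullet> (R *v c) = - (1 / 2) * (m \<bullet> m) - p \<bullet> (R *v c) + z \<bullet> (R *v c)
        - b \<bullet> (R *v c) - (1 / 2) * (c \<bullet> (R *v c))"
      by (simp add: inner_add_left inner_diff_left)
    have 5: "t \<bullet> (D *v t) = b \<bullet> (R *v b) - z \<bullet> (R *v b)"
      unfolding inner_D Tker[OF Mt] z_def[symmetric] b_def[symmetric] 2 ..
    have 6: "k \<bullet> (P *v p) = 0" using sP[of k p] 1 by simp
    have 7: "z \<bullet> (P *v p) = p \<bullet> (R *v b)" using sP[of z p] 2 by (simp add: inner_commute)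
    have 8: "c \<bullet> (R *v b) = b \<bullet> (R *v c)" using sR[of c b] by (simp add: inner_commute)
    have "f (p, t, m) = (p + k - z, (p + k - z) + (b + c))"
      unfolding f_def k_def z_def b_def c_def by (simp add: matrix_vector_right_distrib)
    then show ?thesis
      unfolding 5 using 3 4 6 7 8
      by (simp add: q_shift matrix_vector_right_distrib matrix_vector_mult_diff_distrib 1 2
          inner_add_left inner_add_right inner_diff_left inner_diff_right)
  qed
  let ?S = "NP \<times> ND \<times> C'"
  have subS: "subspace ?S" using NP(1) ND(1) subC' by (intro subspace_Times)
  have qneg: "q (f s) < 0" if "s \<in> ?S" "s \<noteq> 0" for s
  proof -
    obtain p t m where s: "s = (p, t, m)" by (cases s)
    have "p \<bullet> (P *v p) \<le> 0"
      using NP(3)[of p] that s by (cases "p = 0") auto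
    moreover have "t \<bullet> (D *v t) \<le> 0"
      using ND(3)[of t] that s by (cases "t = 0") auto
    moreover have "p \<bullet> (P *v p) < 0 \<or> t \<bullet> (D *v t) < 0 \<or> m \<bullet> m > 0"
      using NP(3)[of p] ND(3)[of t] that s by (auto simp: zero_prod_def)
    moreover have "q (f s) = p \<bullet> (P *v p) + t \<bullet> (D *v t) - m \<bullet> m"
      unfolding s using that s NDC by (intro qf) auto
    ultimately show ?thesis
      using inner_ge_zero[of m] by linarith
  qed
  have q0: "q 0 = 0" by (simp add: q_def zero_prod_def)
  \<comment> \<open>Injectivity comes for free from the negativity of \<open>q\<close>.\<close>
  have "inj_on f ?S"
    unfolding linear_injective_on_subspace_0[OF \<open>linear f\<close> subS]
    using qneg q0 by force
  then have dimH2: "dim (f ` ?S) = ind P + ind D + dim C'"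
    using NP(1,2) ND(1,2) subC' subS
    by (simp add: dim_image_eq[OF \<open>linear f\<close>] dim_Times subspace_Times span_eq_iff[THEN iffD2])
  have H2: "subspace (f ` ?S)" using \<open>linear f\<close> subS by (rule linear_subspace_image)

  define g where "g = (\<lambda>(x, t). (x - Z *v t, (x - Z *v t) + B *v t))"
  let ?K = "?orth NP \<times> {t \<in> C. \<forall>w\<in>ND. orthogonal w t}"
  have "subspace {t \<in> C. \<forall>w\<in>ND. orthogonal w t}"
    using subC by (auto simp: subspace_def orthogonal_def inner_add_right)
  note subDs = this subspace_orthogonal_complement[of NP]
  have "linear g"
    unfolding g_def
    by (rule linearI)
      (auto simp: matrix_vector_right_distrib matrix_vector_mult_scaleR algebra_simps)
  have "inj g"
  proof (rule linear_injective_0[THEN iffD2, OF \<open>linear g\<close>], intro allI impI)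
    fix s assume *: "g s = 0"
    obtain x t where s: "s = (x, t)" by (cases s)
    obtain B' where "B' ** B = mat 1" using invB by (auto simp: invertible_def)
    then have "B' *v (B *v t) = t" by (simp add: matrix_vector_mul_assoc)
    moreover have "B *v t = 0" using * by (auto simp: g_def s zero_prod_def)
    ultimately have "t = 0" by simp
    then show "s = 0" using * by (simp add: g_def s zero_prod_def)
  qed
  have subK: "subspace ?K" using subDs by (intro subspace_Times)
  have dimK2: "dim (g ` ?K) = dim (?orth NP) + dim {t \<in> C. \<forall>w\<in>ND. orthogonal w t}"
    using dim_image_eq[OF \<open>linear g\<close>, of ?K] \<open>inj g\<close> subDs by (simp add: dim_Times inj_on_subset)
  have K2: "subspace (g ` ?K)" using \<open>linear g\<close> subK by (rule linear_subspace_image)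
  have qnonneg: "q (g s) \<ge> 0" if "s \<in> ?K" for s
  proof -
    obtain x t where s: "s = (x, t)" by (cases s)
    have Mt: "M *v t = 0" using that s by (simp add: C_def)
    have "q (g s) = x \<bullet> (P *v x) + t \<bullet> (D *v t)"
      using PZ[OF Mt] sP[of "Z *v t" x]
      unfolding s g_def inner_D Tker[OF Mt]
      by (simp add: q_shift matrix_vector_mult_diff_distrib inner_diff_left inner_diff_right inner_commute)
    then show ?thesis using NP(4)[of x] ND(4)[of t] that s by (simp add: orthogonal_def)
  qed
  have H1K2: "dim (NS \<times> NR) + dim (g ` ?K) \<le> DIM((real^'n) \<times> (real^'n))"
  proof (rule dim_add_le_if_trivial_Int)
    fix v assume v: "v \<in> NS \<times> NR" "v \<in> g ` ?K"
    obtain x y where xy: "v = (x, y)" by (cases v)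
    have "q v \<ge> 0" using v(2) qnonneg by blast
    then show "v = 0"
      using NS(3)[of x] NR(3)[of y] v(1) xy unfolding q_def by (force simp: zero_prod_def)
  qed (use NS(1) NR(1) K2 in \<open>auto intro: subspace_Times\<close>)
  have H2K1: "dim (f ` ?S) + dim (?orth NS \<times> ?orth NR) \<le> DIM((real^'n) \<times> (real^'n))"
  proof (rule dim_add_le_if_trivial_Int)
    fix v assume v: "v \<in> f ` ?S" "v \<in> ?orth NS \<times> ?orth NR"
    obtain x y where xy: "v = (x, y)" by (cases v)
    have "q v \<ge> 0"
      using NS(4)[of x] NR(4)[of y] v(2) xy unfolding q_def by simp
    moreover obtain s where "s \<in> ?S" "v = f s" using v(1) by blast
    ultimately have "s = 0" using qneg[of s] by force
    then show "v = 0" using \<open>v = f s\<close> linear_0[OF \<open>linear f\<close>] by simp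
  qed (use H2 in \<open>auto intro: subspace_Times subspace_orthogonal_complement\<close>)
  have "dim C' + dim C = CARD('n)"
    using dim_orthogonal_complement[OF subC] by (simp add: C'_def)
  moreover have "dim C + rank M = CARD('n)"
    using dim_kernel_plus_rank[of M] by (simp add: C_def)
  moreover have "dim {t \<in> C. \<forall>w\<in>ND. orthogonal w t} + ind D = dim C"
    using dim_subspace_orthogonal_to_vectors[OF ND(1) subC NDC] ND(2) by simp
  moreover have "dim (?orth NP) + ind P = CARD('n)" "dim (?orth NS) + ind (P - R) = CARD('n)"
      "dim (?orth NR) + ind R = CARD('n)"
    using dim_orthogonal_complement NP(1,2) NS(1,2) NR(1,2) by fastforce+
  moreover have "dim (NS \<times> NR) = ind (P - R) + ind R"
    using NS(1,2) NR(1,2) by (simp add: dim_Times)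
  moreover have "dim (?orth NS \<times> ?orth NR) = dim (?orth NS) + dim (?orth NR)"
    by (intro dim_Times subspace_orthogonal_complement)
  moreover have "DIM((real^'n) \<times> (real^'n)) = CARD('n) + CARD('n)" by simp
  ultimately show ?thesis using H1K2 H2K1 dimH2 dimK2 ci by linarith
qed

section \<open>Products and inverses of matrices\<close>

lemma bounded_bilinear_matrix_mult:
  "bounded_bilinear ((**) :: real^'n::finite^'m::finite \<Rightarrow> real^'p::finite^'n \<Rightarrow> real^'p^'m)"
proof -
  have "bilinear ((**) :: real^'n^'m \<Rightarrow> real^'p^'n \<Rightarrow> real^'p^'m)"
    by (simp add: bilinear_def linear_iff vec_eq_iff matrix_matrix_mult_def sum.distrib
        distrib_left distrib_right sum_distrib_left mult.assoc mult.left_commute)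
  then show ?thesis by (simp add: bilinear_conv_bounded_bilinear)
qed

lemma bounded_bilinear_matrix_vector_mult:
  "bounded_bilinear ((*v) :: real^'n::finite^'m::finite \<Rightarrow> real^'n \<Rightarrow> real^'m)"
proof -
  have "bilinear ((*v) :: real^'n^'m \<Rightarrow> real^'n \<Rightarrow> real^'m)"
    by (simp add: bilinear_def linear_iff matrix_vector_right_distrib matrix_vector_mult_scaleR
        matrix_vector_mult_add_rdistrib scaleR_matrix_vector_assoc)
  then show ?thesis by (simp add: bilinear_conv_bounded_bilinear)
qed

lemmas continuous_on_matrix_mult [continuous_intros] =
  bounded_bilinear.continuous_on [OF bounded_bilinear_matrix_mult]

lemmas matrix_mult_simps =
  bounded_bilinear.add_left [OF bounded_bilinear_matrix_mult]
  bounded_bilinear.add_right [OF bounded_bilinear_matrix_mult]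
  bounded_bilinear.diff_left [OF bounded_bilinear_matrix_mult]
  bounded_bilinear.diff_right [OF bounded_bilinear_matrix_mult]
  bounded_bilinear.minus_left [OF bounded_bilinear_matrix_mult]
  bounded_bilinear.minus_right [OF bounded_bilinear_matrix_mult]
  bounded_bilinear.scaleR_left [OF bounded_bilinear_matrix_mult]
  bounded_bilinear.scaleR_right [OF bounded_bilinear_matrix_mult]
  bounded_bilinear.zero_left [OF bounded_bilinear_matrix_mult]
  bounded_bilinear.zero_right [OF bounded_bilinear_matrix_mult]

lemma transpose_linear_simps:
  "transpose (A + B) = transpose A + transpose B"
  "transpose (A - B) = transpose A - transpose B"
  "transpose (- A) = - transpose A"
  "transpose (c *\<^sub>R A) = c *\<^sub>R transpose A"
  for A B :: "real^'n::finite^'m::finite"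
  by (simp_all add: transpose_def vec_eq_iff)

lemma matrix_inv_mult:
  fixes A :: "real^'n::finite^'n"
  assumes "invertible A"
  shows "A ** matrix_inv A = mat 1" "matrix_inv A ** A = mat 1"
proof -
  have "A ** matrix_inv A = mat 1 \<and> matrix_inv A ** A = mat 1"
    unfolding matrix_inv_def by (rule someI_ex) (use assms in \<open>simp add: invertible_def\<close>)
  then show "A ** matrix_inv A = mat 1" "matrix_inv A ** A = mat 1" by auto
qed

lemma rank_mult_invertible:
  fixes A :: "real^'n::finite^'n" and B :: "real^'n^'m::finite"
  assumes "invertible A"
  shows "rank (B ** A) = rank B"
proof (rule antisym[OF rank_mul_le_left])
  have "B = (B ** A) ** matrix_inv A"
    by (simp add: matrix_inv_mult[OF assms] flip: matrix_mul_assoc)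
  then show "rank B \<le> rank (B ** A)" by (metis rank_mul_le_left)
qed

lemma rank_mult_transpose_invertible:
  fixes A :: "real^'n::finite^'n" and B :: "real^'m::finite^'n"
  assumes "invertible A"
  shows "rank (transpose A ** B) = rank B"
  using rank_mult_invertible[OF assms, of "transpose B"]
  by (metis matrix_transpose_mul rank_transpose transpose_transpose)

lemma continuous_on_det:
  fixes f :: "'a::topological_space \<Rightarrow> real^'n::finite^'n"
  assumes "continuous_on S f"
  shows "continuous_on S (\<lambda>x. det (f x))"
  unfolding det_def using assms by (intro continuous_intros)

text \<open>By Cramer's rule the entries of the inverse are quotients of determinants.\<close>

lemma continuous_on_matrix_inv:
  fixes f :: "'a::topological_space \<Rightarrow> real^'n::finite^'n"
  assumes f: "continuous_on S f" and inv: "\<And>x. x \<in> S \<Longrightarrow> invertible (f x)"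
  shows "continuous_on S (\<lambda>x. matrix_inv (f x))"
proof -
  define C where "C = (\<lambda>x. \<chi> i j. det (\<chi> k l. if l = i then axis j 1 $ k else f x $ k $ l) / det (f x))"
  have eq: "matrix_inv (f x) = C x" if "x \<in> S" for x
  proof -
    have "det (f x) \<noteq> 0" using inv[OF that] by (simp add: invertible_det_nz)
    have "matrix_inv (f x) *v axis j 1 = C x *v axis j 1" for j
    proof -
      have "f x *v (matrix_inv (f x) *v axis j 1) = axis j 1"
        by (simp add: matrix_vector_mul_assoc matrix_inv_mult[OF inv[OF that]])
      then show ?thesis
        unfolding cramer[OF \<open>det (f x) \<noteq> 0\<close>]
        by (simp add: C_def matrix_vector_mult_basis column_def)
    qed
    then show ?thesis
      by (simp add: matrix_vector_mult_basis column_def vec_eq_iff)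
  qed
  have "continuous_on S (\<lambda>x. \<chi> k l. if l = i then axis j 1 $ k else f x $ k $ l)" for i j :: 'n
  proof (intro continuous_intros)
    fix k l
    show "continuous_on S (\<lambda>x. if l = i then axis j 1 $ k else f x $ k $ l)"
      using f by (cases "l = i") (auto intro!: continuous_intros)
  qed
  then have "continuous_on S (\<lambda>x. det (\<chi> k l. if l = i then axis j 1 $ k else f x $ k $ l))" for i j
    by (rule continuous_on_det)
  then have "continuous_on S C"
    unfolding C_def using inv
    by (intro continuous_on_vec_lambda continuous_on_divide continuous_on_det[OF f])
      (auto simp: invertible_det_nz)
  then show ?thesis using eq by (simp cong: continuous_on_cong)
qed

section \<open>Lagrangian subspaces as graphs\<close>

lemma sum_UNIV_sum_type:
  "(\<Sum>i\<in>UNIV. f i) = (\<Sum>i\<in>UNIV. f (Inl i)) + (\<Sum>i\<in>UNIV. f (Inr i))"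
  for f :: "'a::finite + 'b::finite \<Rightarrow> 'c::comm_monoid_add"
  using sum.Plus[of "UNIV :: 'a set" "UNIV :: 'b set" f] by (simp add: comp_def)

lemma sum_mat1_mult:
  fixes f :: "'n::finite \<Rightarrow> real"
  shows "(\<Sum>k\<in>UNIV. mat 1 $ i $ k * f k) = f i" "(\<Sum>k\<in>UNIV. f k * mat 1 $ k $ i) = f i"
proof -
  have "(\<Sum>k\<in>UNIV. mat 1 $ i $ k * f k) = (\<Sum>k\<in>UNIV. if i = k then f k else 0)"
    by (intro sum.cong) (auto simp: mat_def)
  then show "(\<Sum>k\<in>UNIV. mat 1 $ i $ k * f k) = f i" by simp
  have "(\<Sum>k\<in>UNIV. f k * mat 1 $ k $ i) = (\<Sum>k\<in>UNIV. if k = i then f k else 0)"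
    by (intro sum.cong) (auto simp: mat_def)
  then show "(\<Sum>k\<in>UNIV. f k * mat 1 $ k $ i) = f i" by simp
qed

lemma JJ_entries:
  "JJ $ Inl i $ Inl j = 0" "JJ $ Inl i $ Inr j = mat 1 $ i $ j"
  "JJ $ Inr i $ Inl j = - mat 1 $ i $ j" "JJ $ Inr i $ Inr j = 0"
  by (simp_all add: JJ_def block4_def)

lemma JJ_mult: "JJ ** Y = block2 (lower_block Y) (- upper_block Y)"
  for Y :: "real^'n::finite^('n + 'n)"
  unfolding vec_eq_iff
proof (intro allI)
  fix i :: "'n + 'n" and j
  show "(JJ ** Y) $ i $ j = block2 (lower_block Y) (- upper_block Y) $ i $ j"
    by (cases i) (simp_all add: matrix_matrix_mult_def sum_UNIV_sum_type JJ_entries sum_mat1_mult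
        block2_def lower_block_def upper_block_def sum_negf)
qed

lemma wronskian_blocks:
  "wronskian Y Y' = transpose (upper_block Y) ** lower_block Y' - transpose (lower_block Y) ** upper_block Y'"
  unfolding wronskian_def matrix_mul_assoc[symmetric] JJ_mult
  by (simp add: vec_eq_iff matrix_matrix_mult_def sum_UNIV_sum_type transpose_def block2_def
      lower_block_def upper_block_def sum_negf)

lemma transpose_JJ: "transpose JJ = - (JJ :: real^('n::finite + 'n)^('n + 'n))"
  unfolding vec_eq_iff
proof (intro allI)
  fix i j :: "'n + 'n"
  show "transpose JJ $ i $ j = (- JJ :: real^('n + 'n)^('n + 'n)) $ i $ j"
    by (cases i; cases j) (auto simp: transpose_def JJ_entries mat_def)
qed

lemma JJ_JJ: "JJ ** JJ = - (mat 1 :: real^('n::finite + 'n)^('n + 'n))"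
  unfolding vec_eq_iff
proof (intro allI)
  fix i j :: "'n + 'n"
  show "(JJ ** JJ) $ i $ j = (- mat 1 :: real^('n + 'n)^('n + 'n)) $ i $ j"
    by (cases i; cases j) (simp_all add: matrix_matrix_mult_def sum_UNIV_sum_type JJ_entries
        sum_mat1_mult sum_negf, simp_all add: mat_def)
qed

lemma continuous_on_upper_block [continuous_intros]:
  "continuous_on S f \<Longrightarrow> continuous_on S (\<lambda>x. upper_block (f x))"
  for f :: "'a::topological_space \<Rightarrow> real^'n::finite^('n + 'n)"
  unfolding upper_block_def by (intro continuous_intros)

lemma continuous_on_lower_block [continuous_intros]:
  "continuous_on S f \<Longrightarrow> continuous_on S (\<lambda>x. lower_block (f x))"
  for f :: "'a::topological_space \<Rightarrow> real^'n::finite^('n + 'n)"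
  unfolding lower_block_def by (intro continuous_intros)

lemma upper_block_mult_col0I: "upper_block (W ** col0I) = upper_right_block W"
  by (simp add: vec_eq_iff upper_block_def upper_right_block_def matrix_matrix_mult_def
      sum_UNIV_sum_type col0I_def block2_def sum_mat1_mult)

lemma wronskian_col0I: "wronskian Y col0I = transpose (upper_block Y)"
proof -
  have "lower_block (col0I :: real^'a^('a + 'a)) = mat 1" "upper_block (col0I :: real^'a^('a + 'a)) = 0"
    by (simp_all add: vec_eq_iff lower_block_def upper_block_def col0I_def block2_def)
  then show ?thesis by (simp add: wronskian_blocks matrix_mult_simps)
qed

lemma wronskian_symplectic:
  assumes "symplectic W"
  shows "wronskian (W ** Y) (W ** Y') = wronskian Y Y'"
proof -
  have "wronskian (W ** Y) (W ** Y') = transpose Y ** (transpose W ** JJ ** W) ** Y'"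
    unfolding wronskian_def by (simp add: matrix_transpose_mul matrix_mul_assoc)
  then show ?thesis using assms by (simp add: wronskian_def symplectic_def)
qed

text \<open>The columns form a basis of a Lagrangian subspace; \<open>wronskian Y Y = 0\<close> is the symmetry of \<open>X\<^sup>T U\<close>.\<close>

definition lagrangian :: "real^'n::finite^('n + 'n) \<Rightarrow> bool" where
  "lagrangian Y \<longleftrightarrow> wronskian Y Y = 0 \<and> (\<forall>v. Y *v v = 0 \<longrightarrow> v = 0)"

lemma symplectic_invertible:
  assumes "symplectic W"
  shows "invertible W"
proof -
  have "(transpose JJ ** transpose W ** JJ) ** W = transpose JJ ** JJ"
    using assms by (simp add: symplectic_def flip: matrix_mul_assoc)
  also have "\<dots> = mat 1" by (simp add: transpose_JJ JJ_JJ matrix_mult_simps)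
  finally show ?thesis by (meson invertible_left_inverse)
qed

lemma lagrangian_symplectic_mult:
  assumes "symplectic W" "lagrangian Y"
  shows "lagrangian (W ** Y)"
proof -
  have "v = 0" if "(W ** Y) *v v = 0" for v
  proof -
    have "matrix_inv W *v (W *v (Y *v v)) = 0" using that by (simp add: matrix_vector_mul_assoc)
    then have "Y *v v = 0"
      by (simp only: matrix_vector_mul_assoc matrix_inv_mult[OF symplectic_invertible[OF assms(1)]]
          matrix_vector_mul_lid matrix_mul_assoc matrix_mul_lid)
    then show ?thesis using assms(2) by (simp add: lagrangian_def)
  qed
  then show ?thesis using assms by (simp add: lagrangian_def wronskian_symplectic)
qed

lemma lagrangian_col0I: "lagrangian col0I"
proof -
  have "v = 0" if "col0I *v v = 0" for v :: "real^'a"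
  proof -
    have "(col0I *v v) $ Inr i = v $ i" for i
      by (simp add: col0I_def block2_def matrix_vector_mult_def sum_mat1_mult)
    then show ?thesis using that by (simp add: vec_eq_iff)
  qed
  moreover have "upper_block (col0I :: real^'a^('a + 'a)) = 0"
    by (simp_all add: vec_eq_iff upper_block_def col0I_def block2_def)
  ultimately show ?thesis
    unfolding lagrangian_def wronskian_col0I by (simp add: transpose_def vec_eq_iff)
qed

definition sheared_lower :: "real \<Rightarrow> real^'n::finite^('n + 'n) \<Rightarrow> real^'n^'n" where
  "sheared_lower k Y = lower_block Y - k *\<^sub>R upper_block Y"

text \<open>After the shear \<open>(x, u) \<mapsto> (x, u - k x)\<close>, which fixes all vectors with \<open>x = 0\<close>, the column space of \<open>Y\<close> is
  the graph \<open>{(Q w, w)}\<close> of this matrix \<open>Q\<close>, provided that the sheared lower block is invertible.\<close>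

definition slope :: "real \<Rightarrow> real^'n::finite^('n + 'n) \<Rightarrow> real^'n^'n" where
  "slope k Y = upper_block Y ** matrix_inv (sheared_lower k Y)"

lemma wronskian_sheared:
  "wronskian Y Y' = transpose (upper_block Y) ** sheared_lower k Y'
     - transpose (sheared_lower k Y) ** upper_block Y'"
  by (simp add: wronskian_blocks sheared_lower_def matrix_mult_simps transpose_linear_simps)

lemma block_matrix_vector_eq_0:
  assumes "upper_block Y *v v = 0" "lower_block Y *v v = 0"
  shows "Y *v v = 0"
proof -
  have "(Y *v v) $ i = 0" for i
    using assms by (cases i) (simp_all add: vec_eq_iff matrix_vector_mult_def upper_block_def lower_block_def)
  then show ?thesis by (simp add: vec_eq_iff)
qed

text \<open>If \<open>U v = k X v\<close> and \<open>U w = l X w\<close> with \<open>k \<noteq> l\<close>, the symmetry of \<open>X\<^sup>T U\<close> makes \<open>X v\<close> and \<open>X w\<close>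
  orthogonal, and neither of them is \<open>0\<close> when \<open>v\<close> and \<open>w\<close> are not. Hence there are at most \<open>n\<close>
  such numbers \<open>k\<close>.\<close>

lemma finite_singular_shears:
  fixes Y :: "real^'n::finite^('n + 'n)"
  assumes "lagrangian Y"
  shows "finite {k. \<not> invertible (sheared_lower k Y)}" (is "finite ?K")
proof -
  define X where "X = upper_block Y"
  define U where "U = lower_block Y"
  have iso: "transpose X ** U = transpose U ** X"
    using assms by (simp add: lagrangian_def wronskian_blocks X_def U_def)
  have "\<exists>v. v \<noteq> 0 \<and> U *v v = k *\<^sub>R (X *v v)" if "k \<in> ?K" for k
  proof -
    have "\<not> (\<exists>B. B ** sheared_lower k Y = mat 1)"
      using that by (simp add: invertible_left_inverse)
    then obtain v where "v \<noteq> 0" "sheared_lower k Y *v v = 0"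
      unfolding matrix_left_invertible_ker by blast
    then show ?thesis
      by (auto simp: sheared_lower_def X_def U_def matrix_vector_mult_diff_rdistrib
          scaleR_matrix_vector_assoc[symmetric] intro!: exI[of _ v])
  qed
  then obtain v where v: "\<And>k. k \<in> ?K \<Longrightarrow> v k \<noteq> 0" "\<And>k. k \<in> ?K \<Longrightarrow> U *v v k = k *\<^sub>R (X *v v k)"
    by metis
  define w where "w = (\<lambda>k. X *v v k)"
  have w0: "w k \<noteq> 0" if "k \<in> ?K" for k
  proof
    assume "w k = 0"
    then have "Y *v v k = 0"
      using v(2)[OF that] by (intro block_matrix_vector_eq_0) (simp_all add: w_def X_def U_def)
    then show False using assms v(1)[OF that] by (simp add: lagrangian_def)
  qed
  have orth: "w k \<bullet> w l = 0" if "k \<in> ?K" "l \<in> ?K" "k \<noteq> l" for k l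
  proof -
    have "(X *v v k) \<bullet> (U *v v l) = v k \<bullet> ((transpose X ** U) *v v l)"
      using inner_matrix_vector_transpose[of "v k" "transpose X" "U *v v l"]
      by (simp add: matrix_vector_mul_assoc)
    also have "\<dots> = (U *v v k) \<bullet> (X *v v l)"
      unfolding iso using inner_matrix_vector_transpose[of "v k" "transpose U" "X *v v l"]
      by (simp add: matrix_vector_mul_assoc)
    finally have "l * (w k \<bullet> w l) = k * (w k \<bullet> w l)"
      using v(2) that by (simp add: w_def)
    then show ?thesis using that(3) by simp
  qed
  have "pairwise orthogonal (w ` ?K)"
    using orth by (auto simp: pairwise_def orthogonal_def)
  moreover have "0 \<notin> w ` ?K" using w0 by auto
  ultimately have "finite (w ` ?K)"
    using pairwise_orthogonal_independent independent_imp_finite by blast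
  moreover have "inj_on w ?K"
    using orth w0 by (intro inj_onI) (metis inner_eq_zero_iff)
  ultimately show ?thesis by (rule finite_imageD)
qed

lemma upper_block_eq_slope_mult:
  assumes "invertible (sheared_lower k Y)"
  shows "upper_block Y = slope k Y ** sheared_lower k Y"
  by (simp add: slope_def matrix_inv_mult[OF assms] flip: matrix_mul_assoc)

lemma symmetric_slope:
  assumes "lagrangian Y" "invertible (sheared_lower k Y)"
  shows "symmetric_mat (slope k Y)"
proof -
  let ?A = "sheared_lower k Y" and ?X = "upper_block Y"
  have iso: "transpose ?X ** ?A = transpose ?A ** ?X"
    using assms(1) wronskian_sheared[of Y Y k] by (simp add: lagrangian_def)
  have t: "transpose (matrix_inv ?A) ** transpose ?A = mat 1"
    by (simp add: matrix_inv_mult[OF assms(2)] transpose_mat flip: matrix_transpose_mul)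
  have "transpose (slope k Y) = transpose (matrix_inv ?A) ** transpose ?X ** (?A ** matrix_inv ?A)"
    by (simp add: slope_def matrix_transpose_mul matrix_inv_mult[OF assms(2)])
  also have "\<dots> = transpose (matrix_inv ?A) ** (transpose ?X ** ?A) ** matrix_inv ?A"
    by (simp add: matrix_mul_assoc)
  also have "\<dots> = (transpose (matrix_inv ?A) ** transpose ?A) ** ?X ** matrix_inv ?A"
    unfolding iso by (simp add: matrix_mul_assoc)
  also have "\<dots> = slope k Y" by (simp add: t slope_def)
  finally show ?thesis by (simp add: symmetric_mat_def)
qed

text \<open>This identity carries the geometry: differences of slopes have the rank of the Wronskian, which
  symplectic matrices preserve, and the derivative of the slope can be computed without
  differentiating an inverse.\<close>

lemma wronskian_slope:
  assumes "lagrangian Y" "invertible (sheared_lower k Y)" "invertible (sheared_lower k Y')"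
  shows "wronskian Y Y' = transpose (sheared_lower k Y) ** (slope k Y - slope k Y') ** sheared_lower k Y'"
proof -
  have "transpose (upper_block Y) = transpose (sheared_lower k Y) ** slope k Y"
    using symmetric_slope[OF assms(1,2)] upper_block_eq_slope_mult[OF assms(2)]
    by (metis matrix_transpose_mul symmetric_mat_def)
  then show ?thesis
    using wronskian_sheared[of Y Y' k] upper_block_eq_slope_mult[OF assms(3)]
    by (simp add: matrix_mult_simps matrix_mul_assoc)
qed

lemma rank_upper_block_eq_rank_slope:
  assumes "invertible (sheared_lower k Y)"
  shows "rank (upper_block Y) = rank (slope k Y)"
  by (metis assms upper_block_eq_slope_mult rank_mult_invertible)

lemma rank_slope_diff:
  assumes "lagrangian Y" "invertible (sheared_lower k Y)" "invertible (sheared_lower k Y')"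
  shows "rank (slope k Y - slope k Y') = rank (wronskian Y Y')"
  by (simp add: wronskian_slope[OF assms] rank_mult_invertible[OF assms(3)]
      rank_mult_transpose_invertible[OF assms(2)])

lemma comparative_index_slope:
  assumes "lagrangian Y" "lagrangian Y'" "invertible (sheared_lower k Y)" "invertible (sheared_lower k Y')"
  shows "comparative_index Y Y' + ind (slope k Y) = ind (slope k Y - slope k Y') + ind (slope k Y')"
  using assms
  by (intro comparative_index_of_graphs[where A = "sheared_lower k Y" and B = "sheared_lower k Y'"]
      symmetric_slope upper_block_eq_slope_mult wronskian_slope)

lemma continuous_on_sheared_lower [continuous_intros]:
  "continuous_on S f \<Longrightarrow> continuous_on S (\<lambda>x. sheared_lower k (f x))"
  for f :: "'a::topological_space \<Rightarrow> real^'n::finite^('n + 'n)"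
  unfolding sheared_lower_def by (intro continuous_intros)

lemma continuous_on_slope:
  fixes f :: "'a::topological_space \<Rightarrow> real^'n::finite^('n + 'n)"
  assumes "continuous_on S f" "\<And>x. x \<in> S \<Longrightarrow> invertible (sheared_lower k (f x))"
  shows "continuous_on S (\<lambda>x. slope k (f x))"
  unfolding slope_def using assms by (intro continuous_intros continuous_on_matrix_inv)

section \<open>Monotone symplectic paths\<close>

text \<open>The condition \<open>\<Psi>(S) \<ge> 0\<close> as a differential equation \<open>S' = \<J> G S\<close> with \<open>G \<ge> 0\<close>, where \<open>G = \<Psi>(S)\<close>.
  In this form it passes to products.\<close>

definition monotone_symplectic :: "(real \<Rightarrow> real^('n::finite + 'n)^('n + 'n)) \<Rightarrow> bool" where
  "monotone_symplectic S \<longleftrightarrow> (\<forall>t. symplectic (S t)) \<and> continuous_on UNIV S \<and>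
     (\<exists>E. (\<forall>c d. finite (E \<inter> {c..d})) \<and>
        (\<forall>t. t \<notin> E \<longrightarrow> (\<exists>G. nonneg_definite G \<and> (S has_vector_derivative JJ ** G ** S t) (at t))))"

lemma monotone_symplectic_if_Psi_nonneg:
  assumes "\<And>t. symplectic (S t)" "C1p S" "Psi_nonneg S"
  shows "monotone_symplectic S"
proof -
  obtain E f' where E: "\<And>c d. finite (E \<inter> {c..d})"
      "\<And>t. t \<in> - E \<Longrightarrow> (S has_vector_derivative f' t) (at t)"
    using assms(2) unfolding C1p_def by blast
  have "nonneg_definite (Psi S t) \<and> (S has_vector_derivative JJ ** Psi S t ** S t) (at t)" if "t \<notin> E" for t
  proof -
    have d: "(S has_vector_derivative f' t) (at t)" using E(2) that by simp
    then have "S differentiable (at t)" by (rule differentiableI_vector)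
    then have nonneg: "nonneg_definite (Psi S t)" using assms(3) by (simp add: Psi_nonneg_def)
    have "JJ ** Psi S t ** S t = (JJ ** transpose JJ) ** f' t ** (matrix_inv (S t) ** S t)"
      using vector_derivative_at[OF d] by (simp add: Psi_def matrix_mul_assoc)
    also have "\<dots> = f' t"
      by (simp add: transpose_JJ JJ_JJ matrix_mult_simps matrix_inv_mult[OF symplectic_invertible[OF assms(1)]])
    finally show ?thesis using nonneg d by simp
  qed
  then show ?thesis
    using assms(1,2) E(1) unfolding monotone_symplectic_def C1p_def by blast
qed

lemma monotone_symplectic_const: "symplectic A \<Longrightarrow> monotone_symplectic (\<lambda>t. A)"
  unfolding monotone_symplectic_def
  by (auto intro!: exI[of _ "{}"] exI[of _ "0 :: real^('a + 'a)^('a + 'a)"]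
      simp: nonneg_definite_def symmetric_mat_def transpose_def vec_eq_iff matrix_mult_simps)

lemma symplectic_mult: "symplectic A \<Longrightarrow> symplectic B \<Longrightarrow> symplectic (A ** B)"
  unfolding symplectic_def by (simp add: matrix_transpose_mul) (metis matrix_mul_assoc)

lemma nonneg_definite_add: "nonneg_definite A \<Longrightarrow> nonneg_definite B \<Longrightarrow> nonneg_definite (A + B)"
  by (simp add: nonneg_definite_def symmetric_mat_def transpose_linear_simps
      matrix_vector_mult_add_rdistrib inner_add_right)

lemma nonneg_definite_congruence:
  fixes C :: "real^'n::finite^'n"
  assumes "nonneg_definite A" 
  shows "nonneg_definite (transpose C ** A ** C)"
proof -
  have "v \<bullet> ((transpose C ** A ** C) *v v) = (C *v v) \<bullet> (A *v (C *v v))" for v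
    using inner_matrix_vector_transpose[of v "transpose C" "A *v (C *v v)"]
    by (simp add: matrix_vector_mul_assoc matrix_mul_assoc)
  then show ?thesis using assms
    by (simp add: nonneg_definite_def symmetric_mat_def matrix_transpose_mul matrix_mul_assoc)
qed

text \<open>\<open>\<Psi>(S R) = \<Psi>(S) + C\<^sup>T \<Psi>(R) C\<close> with \<open>C = S\<^sup>-\<^sup>1\<close>, because \<open>S \<J> = \<J> C\<^sup>T\<close> for symplectic \<open>S\<close>.\<close>

lemma monotone_symplectic_mult:
  assumes "monotone_symplectic S" "monotone_symplectic R"
  shows "monotone_symplectic (\<lambda>t. S t ** R t)"
proof -
  obtain E where E: "\<And>c d. finite (E \<inter> {c..d})"
      "\<And>t. t \<notin> E \<Longrightarrow> \<exists>G. nonneg_definite G \<and> (S has_vector_derivative JJ ** G ** S t) (at t)"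
    using assms(1) unfolding monotone_symplectic_def by blast
  obtain F where F: "\<And>c d. finite (F \<inter> {c..d})"
      "\<And>t. t \<notin> F \<Longrightarrow> \<exists>G. nonneg_definite G \<and> (R has_vector_derivative JJ ** G ** R t) (at t)"
    using assms(2) unfolding monotone_symplectic_def by blast
  have "\<exists>K. nonneg_definite K \<and> ((\<lambda>t. S t ** R t) has_vector_derivative JJ ** K ** (S t ** R t)) (at t)"
    if "t \<notin> E \<union> F" for t
  proof -
    obtain G where G: "nonneg_definite G" "(S has_vector_derivative JJ ** G ** S t) (at t)"
      using E(2) \<open>t \<notin> E \<union> F\<close> by blast
    obtain H where H: "nonneg_definite H" "(R has_vector_derivative JJ ** H ** R t) (at t)"
      using F(2) \<open>t \<notin> E \<union> F\<close> by blast
    define C where "C = matrix_inv (S t)"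
    have sym: "transpose (S t) ** JJ ** S t = JJ" and inv: "S t ** C = mat 1" "C ** S t = mat 1"
      using assms(1) matrix_inv_mult[OF symplectic_invertible[of "S t"]]
      by (auto simp: monotone_symplectic_def symplectic_def C_def)
    have tC: "transpose C ** transpose (S t) = mat 1"
      using inv(1) by (metis matrix_transpose_mul transpose_mat)
    have "JJ ** S t = (transpose C ** transpose (S t)) ** JJ ** S t" by (simp add: tC)
    also have "\<dots> = transpose C ** JJ" using sym by (simp add: matrix_mul_assoc[symmetric])
    finally have JS: "JJ ** S t = transpose C ** JJ" .
    have "S t ** JJ = - (JJ ** JJ) ** S t ** JJ" by (simp add: JJ_JJ)
    also have "\<dots> = - JJ ** (JJ ** S t) ** JJ" by (simp add: matrix_mul_assoc matrix_mult_simps)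
    also have "\<dots> = JJ ** transpose C"
      unfolding JS by (simp add: JJ_JJ matrix_mult_simps flip: matrix_mul_assoc)
    finally have SJ: "S t ** JJ = JJ ** transpose C" .
    have "S t ** (JJ ** H ** R t) = (S t ** JJ) ** H ** (C ** S t) ** R t"
      by (simp add: inv matrix_mul_assoc)
    then have "S t ** (JJ ** H ** R t) = JJ ** (transpose C ** H ** C) ** (S t ** R t)"
      unfolding SJ by (simp add: matrix_mul_assoc)
    then have eq: "S t ** (JJ ** H ** R t) + (JJ ** G ** S t) ** R t
        = JJ ** (transpose C ** H ** C + G) ** (S t ** R t)"
      by (simp add: matrix_mult_simps matrix_mul_assoc)
    have "((\<lambda>t. S t ** R t) has_vector_derivative
        JJ ** (transpose C ** H ** C + G) ** (S t ** R t)) (at t)"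
      using bounded_bilinear.has_vector_derivative[OF bounded_bilinear_matrix_mult G(2) H(2)]
      unfolding eq .
    then show ?thesis
      using nonneg_definite_add[OF nonneg_definite_congruence[OF H(1)] G(1)] by blast
  qed
  moreover have "finite ((E \<union> F) \<inter> {c..d})" for c d
    using E(1) F(1) by (simp add: Int_Un_distrib2)
  ultimately have "\<exists>E. (\<forall>c d. finite (E \<inter> {c..d})) \<and> (\<forall>t. t \<notin> E \<longrightarrow>
      (\<exists>G. nonneg_definite G \<and> ((\<lambda>t. S t ** R t) has_vector_derivative JJ ** G ** (S t ** R t)) (at t)))"
    by blast
  then show ?thesis
    using assms unfolding monotone_symplectic_def
    by (auto intro!: symplectic_mult continuous_intros)
qed

lemma has_vector_derivative_imp_difference_quotient:
  assumes "(f has_vector_derivative D) (at x)"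
  shows "((\<lambda>y. (f y - f x) /\<^sub>R (y - x)) \<longlongrightarrow> D) (at x)"
proof -
  have "((\<lambda>y. (f y - f x - (y - x) *\<^sub>R D) /\<^sub>R norm (y - x)) \<longlongrightarrow> 0) (at x)"
    using assms by (simp add: has_vector_derivative_def has_derivative_def netlimit_at)
  then have "((\<lambda>y. norm ((f y - f x - (y - x) *\<^sub>R D) /\<^sub>R norm (y - x))) \<longlongrightarrow> 0) (at x)"
    by (rule tendsto_norm_zero)
  moreover have "\<forall>\<^sub>F y in at x. norm ((f y - f x - (y - x) *\<^sub>R D) /\<^sub>R norm (y - x))
      = norm ((f y - f x) /\<^sub>R (y - x) - D)"
    unfolding eventually_at_filter
  proof (intro always_eventually allI impI)
    fix y assume "y \<noteq> x"
    then have "(f y - f x) /\<^sub>R (y - x) - D = (f y - f x - (y - x) *\<^sub>R D) /\<^sub>R (y - x)"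
      by (simp add: scaleR_diff_right)
    then show "norm ((f y - f x - (y - x) *\<^sub>R D) /\<^sub>R norm (y - x)) = norm ((f y - f x) /\<^sub>R (y - x) - D)"
      by simp
  qed
  ultimately have "((\<lambda>y. norm ((f y - f x) /\<^sub>R (y - x) - D)) \<longlongrightarrow> 0) (at x)"
    by (rule Lim_transform_eventually)
  then show ?thesis
    using Lim_null tendsto_norm_zero_iff by blast
qed

text \<open>Let \<open>A\<close> be the sheared lower block of \<open>Y = S C\<close> and \<open>u = A\<^sup>-\<^sup>1 v\<close>. By \<open>wronskian_slope\<close> the increment of
  \<open>v \<bullet> Q v\<close> from \<open>t\<close> to \<open>s\<close> is \<open>- u(t) \<bullet> w(Y(t), Y(s)) u(s)\<close>. Since the Wronskian vanishes
  at \<open>s = t\<close>, continuity of \<open>u\<close> suffices to differentiate this at \<open>s = t\<close>, and the result is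
  \<open>Y u \<bullet> G (Y u) \<ge> 0\<close>.\<close>

lemma slope_nondecreasing:
  fixes S :: "real \<Rightarrow> real^('n::finite + 'n)^('n + 'n)" and C :: "real^'n^('n + 'n)"
  assumes S: "monotone_symplectic S" and C: "lagrangian C" and "c \<le> d"
    and inv: "\<And>t. t \<in> {c..d} \<Longrightarrow> invertible (sheared_lower k (S t ** C))"
  shows "v \<bullet> (slope k (S c ** C) *v v) \<le> v \<bullet> (slope k (S d ** C) *v v)"
proof -
  define Y where "Y = (\<lambda>t. S t ** C)"
  define Q where "Q = (\<lambda>t. slope k (Y t))"
  define A where "A = (\<lambda>t. sheared_lower k (Y t))"
  have lag: "lagrangian (Y t)" for t
    using S C by (simp add: Y_def monotone_symplectic_def lagrangian_symplectic_mult)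
  have contS: "continuous_on UNIV S" using S by (simp add: monotone_symplectic_def)
  have contY: "continuous_on {c..d} Y"
    unfolding Y_def by (intro continuous_intros continuous_on_subset[OF contS]) auto
  have invA: "invertible (A t)" if "t \<in> {c..d}" for t using inv[OF that] by (simp add: A_def Y_def)
  have contQ: "continuous_on {c..d} Q"
    unfolding Q_def using contY invA by (intro continuous_on_slope) (auto simp: A_def)
  have contA: "continuous_on {c..d} (\<lambda>t. matrix_inv (A t))"
    unfolding A_def using invA contY by (intro continuous_on_matrix_inv continuous_intros) (auto simp: A_def)
  obtain E where E: "\<And>c d. finite (E \<inter> {c..d})"
      "\<And>t. t \<notin> E \<Longrightarrow> \<exists>G. nonneg_definite G \<and> (S has_vector_derivative JJ ** G ** S t) (at t)"
    using S unfolding monotone_symplectic_def by blast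
  define \<phi> where "\<phi> = (\<lambda>t. v \<bullet> (Q t *v v))"
  have bl: "bounded_linear (\<lambda>M::real^'n^'n. v \<bullet> (M *v v))"
    by (intro linear_conv_bounded_linear[THEN iffD1] linearI)
      (simp_all add: matrix_vector_mult_add_rdistrib inner_add_right scaleR_matrix_vector_assoc[symmetric])
  have cont\<phi>: "continuous_on {c..d} \<phi>"
    unfolding \<phi>_def using bounded_linear.continuous_on[OF bl contQ] .
  have "\<exists>D\<ge>0. (\<phi> has_vector_derivative D) (at t)" if t: "t \<in> {c<..<d} - E" for t
  proof -
    obtain G where G: "nonneg_definite G" "(S has_vector_derivative JJ ** G ** S t) (at t)"
      using E(2) t by blast
    define u where "u = (\<lambda>s. matrix_inv (A s) *v v)"
    define h where "h = (\<lambda>s. wronskian (Y t) (Y s))"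
    have "(Y has_vector_derivative JJ ** G ** Y t) (at t)"
      using bounded_linear.has_vector_derivative[OF
          bounded_bilinear.bounded_linear_left[OF bounded_bilinear_matrix_mult, of C] G(2)]
      by (simp add: Y_def matrix_mul_assoc)
    from bounded_linear.has_vector_derivative[OF
          bounded_bilinear.bounded_linear_right[OF bounded_bilinear_matrix_mult, of "transpose (Y t) ** JJ"] this]
    have "(h has_vector_derivative transpose (Y t) ** JJ ** (JJ ** G ** Y t)) (at t)"
      by (simp add: h_def wronskian_def)
    also have "transpose (Y t) ** JJ ** (JJ ** G ** Y t) = - (transpose (Y t) ** G ** Y t)"
    proof -
      have "transpose (Y t) ** JJ ** (JJ ** G ** Y t) = transpose (Y t) ** (JJ ** JJ) ** G ** Y t"
        by (simp add: matrix_mul_assoc)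
      then show ?thesis by (simp add: JJ_JJ matrix_mult_simps)
    qed
    finally have lim: "((\<lambda>s. (h s - h t) /\<^sub>R (s - t)) \<longlongrightarrow> - (transpose (Y t) ** G ** Y t)) (at t)"
      by (rule has_vector_derivative_imp_difference_quotient)
    have h0: "h t = 0" using lag by (simp add: h_def lagrangian_def)
    have "isCont (\<lambda>t. matrix_inv (A t)) t"
      using contA t by (intro continuous_on_interior[OF contA]) (simp add: interior_atLeastAtMost_real)
    then have limu: "(u \<longlongrightarrow> u t) (at t)"
      unfolding u_def isCont_def
      by (intro bounded_bilinear.tendsto[OF bounded_bilinear_matrix_vector_mult] tendsto_const)
    have "((\<lambda>s. - (u t \<bullet> (((h s - h t) /\<^sub>R (s - t)) *v u s)))
        \<longlongrightarrow> - (u t \<bullet> ((- (transpose (Y t) ** G ** Y t)) *v u t))) (at t)"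
      by (intro tendsto_intros bounded_bilinear.tendsto[OF bounded_bilinear_matrix_vector_mult] lim limu)
    moreover have "\<forall>\<^sub>F s in at t. - (u t \<bullet> (((h s - h t) /\<^sub>R (s - t)) *v u s)) = (\<phi> s - \<phi> t) / (s - t)"
    proof -
      have "\<forall>\<^sub>F s in at t. s \<in> {c<..<d}"
        using t by (intro eventually_at_in_open') auto
      then show ?thesis
      proof eventually_elim
        case (elim s)
        have st: "s \<in> {c..d}" "t \<in> {c..d}" using elim t by auto
        have Au: "A r *v u r = v" if "r \<in> {c..d}" for r
          by (simp add: u_def matrix_vector_mul_assoc matrix_inv_mult[OF invA[OF that]])
        have "u t \<bullet> (h s *v u s) = u t \<bullet> (transpose (A t) *v ((Q t - Q s) *v (A s *v u s)))"
          unfolding h_def Q_def A_def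
          using wronskian_slope[OF lag invA[OF st(2), unfolded A_def] invA[OF st(1), unfolded A_def]]
          by (simp add: matrix_vector_mul_assoc matrix_mul_assoc)
        also have "\<dots> = (A t *v u t) \<bullet> ((Q t - Q s) *v (A s *v u s))"
          using inner_matrix_vector_transpose[of "u t" "transpose (A t)"] by simp
        also have "\<dots> = \<phi> t - \<phi> s"
          unfolding Au[OF st(1)] Au[OF st(2)] \<phi>_def
          by (simp add: matrix_vector_mult_diff_rdistrib inner_diff_right)
        finally show ?case
          by (simp add: h0 scaleR_matrix_vector_assoc[symmetric] divide_inverse_commute right_diff_distrib)
      qed
    qed
    ultimately have "((\<lambda>s. (\<phi> s - \<phi> t) / (s - t)) \<longlongrightarrow> - (u t \<bullet> ((- (transpose (Y t) ** G ** Y t)) *v u t))) (at t)"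
      by (rule Lim_transform_eventually)
    moreover have "- (u t \<bullet> ((- (transpose (Y t) ** G ** Y t)) *v u t)) \<ge> 0"
    proof -
      have "u t \<bullet> ((transpose (Y t) ** G ** Y t) *v u t) = (Y t *v u t) \<bullet> (G *v (Y t *v u t))"
        using inner_matrix_vector_transpose[of "u t" "transpose (Y t)" "G *v (Y t *v u t)"]
        by (simp add: matrix_vector_mul_assoc matrix_mul_assoc)
      then show ?thesis using G(1) by (simp add: uminus_matrix_vector nonneg_definite_def)
    qed
    ultimately show ?thesis
      unfolding has_real_derivative_iff_has_vector_derivative[symmetric] has_field_derivative_iff by blast
  qed
  then obtain D where D: "\<And>t. t \<in> {c<..<d} - E \<Longrightarrow> D t \<ge> 0"
      "\<And>t. t \<in> {c<..<d} - E \<Longrightarrow> (\<phi> has_vector_derivative D t) (at t)"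
    by metis
  define D' where "D' = (\<lambda>t. if t \<in> {c<..<d} - E then D t else 0)"
  have "(D' has_integral (\<phi> d - \<phi> c)) {c..d}"
  proof (rule fundamental_theorem_of_calculus_interior_strong[OF E(1)[of c d] \<open>c \<le> d\<close> _ cont\<phi>])
    fix x assume "x \<in> {c<..<d} - E \<inter> {c..d}"
    then show "(\<phi> has_vector_derivative D' x) (at x)" using D(2)[of x] by (auto simp: D'_def)
  qed
  then have "0 \<le> \<phi> d - \<phi> c"
    by (rule has_integral_nonneg) (use D(1) in \<open>auto simp: D'_def\<close>)
  then show ?thesis by (simp add: \<phi>_def Q_def Y_def)
qed

section \<open>Monotonicity and continuity of the index\<close>

lemma ind_antimono:
  fixes A B :: "real^'n::finite^'n"
  assumes "symmetric_mat A" "symmetric_mat B" "\<And>v. v \<bullet> (A *v v) \<le> v \<bullet> (B *v v)"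
  shows "ind B \<le> ind A"
proof -
  obtain N where N: "subspace N" "dim N = ind B" "\<And>v. v \<in> N \<Longrightarrow> v \<noteq> 0 \<Longrightarrow> v \<bullet> (B *v v) < 0"
    using ind_decomposition[OF assms(2)] by metis
  have "dim N \<le> ind A"
    using assms(3) N(3) by (intro dim_le_ind_if_negative_definite assms(1) N(1)) (meson le_less_trans)
  then show ?thesis using N(2) by simp
qed

text \<open>Negative definiteness on a fixed subspace is stable under small perturbations, by compactness of the
  unit sphere.\<close>

lemma ind_lower_semicontinuous:
  fixes Q :: "'a::metric_space \<Rightarrow> real^'n::finite^'n"
  assumes cont: "continuous_on S Q" and sym: "\<And>x. x \<in> S \<Longrightarrow> symmetric_mat (Q x)" and "x \<in> S"
  shows "\<exists>d>0. \<forall>y\<in>S. dist y x < d \<longrightarrow> ind (Q x) \<le> ind (Q y)"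
proof -
  obtain N where N: "subspace N" "dim N = ind (Q x)"
      "\<And>v. v \<in> N \<Longrightarrow> v \<noteq> 0 \<Longrightarrow> v \<bullet> (Q x *v v) < 0"
    using ind_decomposition[OF sym[OF \<open>x \<in> S\<close>]] by metis
  let ?K = "N \<inter> sphere 0 1"
  obtain m where m: "m > 0" "\<And>v. v \<in> ?K \<Longrightarrow> v \<bullet> (Q x *v v) \<le> - m"
  proof (cases "?K = {}")
    case True
    then show thesis by (intro that[of 1]) auto
  next
    case False
    have comp: "compact ?K"
      using N(1) by (intro closed_Int_compact closed_subspace) auto
    have "continuous_on ?K (\<lambda>v. v \<bullet> (Q x *v v))"
      by (intro continuous_intros linear_continuous_on) auto
    from continuous_attains_sup[OF comp False this]
    obtain u where u: "u \<in> ?K" "\<And>v. v \<in> ?K \<Longrightarrow> v \<bullet> (Q x *v v) \<le> u \<bullet> (Q x *v u)"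
      by blast
    then have "u \<noteq> 0" "u \<in> N" by auto
    then show thesis using u(2) N(3)[of u] by (intro that[of "- (u \<bullet> (Q x *v u))"]) simp_all
  qed
  obtain K where K: "K > 0" "\<And>(A::real^'n^'n) (v::real^'n). norm (A *v v) \<le> norm A * norm v * K"
    using bounded_bilinear.pos_bounded[OF bounded_bilinear_matrix_vector_mult] by blast
  have "m / K > 0" using m(1) K(1) by simp
  then obtain d where d: "d > 0" "\<And>y. y \<in> S \<Longrightarrow> dist y x < d \<Longrightarrow> dist (Q y) (Q x) < m / K"
    using cont \<open>x \<in> S\<close> unfolding continuous_on_iff by metis
  have "ind (Q x) \<le> ind (Q y)" if y: "y \<in> S" "dist y x < d" for y
  proof -
    have unit: "v \<bullet> (Q y *v v) < 0" if "v \<in> ?K" for v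
    proof -
      have nv: "norm v = 1" using that by simp
      have "v \<bullet> (Q y *v v) = v \<bullet> (Q x *v v) + v \<bullet> ((Q y - Q x) *v v)"
        by (simp add: matrix_vector_mult_diff_rdistrib inner_diff_right)
      also have "v \<bullet> ((Q y - Q x) *v v) \<le> norm v * norm ((Q y - Q x) *v v)"
        by (rule norm_cauchy_schwarz)
      also have "\<dots> \<le> norm (Q y - Q x) * K"
        using K(2)[of "Q y - Q x" v] nv by simp
      also have "\<dots> < m"
        using d(2)[OF y] K(1) by (simp add: dist_norm field_simps)
      finally show ?thesis using m(2)[OF that] by simp
    qed
    have "v \<bullet> (Q y *v v) < 0" if "v \<in> N" "v \<noteq> 0" for v
    proof -
      have "v /\<^sub>R norm v \<in> ?K" using that N(1) by (auto simp: subspace_scale)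
      from unit[OF this] have "v \<bullet> (Q y *v v) / (norm v)\<^sup>2 < 0"
        by (simp add: matrix_vector_mult_scaleR field_simps power2_eq_square)
      then show ?thesis using that(2) by (simp add: divide_less_0_iff)
    qed
    then show ?thesis
      using dim_le_ind_if_negative_definite[OF sym[OF y(1)] N(1)] N(2) by simp
  qed
  then show ?thesis using d(1) by blast
qed

text \<open>The indices of \<open>Q\<close> and \<open>- Q\<close> are both lower semicontinuous, and their sum is the constant rank, so
  neither of them can jump.\<close>

lemma ind_constant_if_rank_constant:
  fixes Q :: "'a::metric_space \<Rightarrow> real^'n::finite^'n"
  assumes "connected S" and cont: "continuous_on S Q" and sym: "\<And>x. x \<in> S \<Longrightarrow> symmetric_mat (Q x)"
    and rank: "\<And>x. x \<in> S \<Longrightarrow> rank (Q x) = r" and "x \<in> S" "y \<in> S"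
  shows "ind (Q x) = ind (Q y)"
proof (rule connected_local_const[OF \<open>connected S\<close> \<open>x \<in> S\<close> \<open>y \<in> S\<close>], intro ballI)
  fix z assume z: "z \<in> S"
  have contm: "continuous_on S (\<lambda>x. - Q x)" using cont by (intro continuous_intros)
  obtain d where d: "d > 0" "\<forall>y\<in>S. dist y z < d \<longrightarrow> ind (Q z) \<le> ind (Q y)"
    using ind_lower_semicontinuous[OF cont sym z] by blast
  obtain e where e: "e > 0" "\<forall>y\<in>S. dist y z < e \<longrightarrow> ind (- Q z) \<le> ind (- Q y)"
    using ind_lower_semicontinuous[OF contm symmetric_mat_uminus[OF sym] z] by blast
  have "ind (Q z) = ind (Q y)" if "y \<in> S" "dist y z < min d e" for y
    using d(2) e(2) that rank_eq_ind_plus_ind_uminus[OF sym[OF that(1)]]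
      rank_eq_ind_plus_ind_uminus[OF sym[OF z]] rank[OF that(1)] rank[OF z] by fastforce
  moreover have "min d e > 0" using d(1) e(1) by simp
  ultimately show "\<forall>\<^sub>F b in at z within S. ind (Q z) = ind (Q b)"
    unfolding eventually_at by blast
qed

section \<open>Focal points as drops of the index\<close>

definition rank_drop :: "(real \<Rightarrow> real^'n::finite^('n + 'n)) \<Rightarrow> real \<Rightarrow> int" where
  "rank_drop Y t = Lim (at_left t) (\<lambda>s. int (rank (upper_block (Y s)))) - int (rank (upper_block (Y t)))"

text \<open>Sums over infinite supports are \<open>0\<close> by convention, so additivity of \<open>l_c\<close> in the interval requires that
  finiteness be carried along.\<close>

definition finite_drops :: "(real \<Rightarrow> real^'n::finite^('n + 'n)) \<Rightarrow> real \<Rightarrow> real \<Rightarrow> bool" where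
  "finite_drops Y a b \<longleftrightarrow> finite (support_on {a<..b} (rank_drop Y))"

lemma l_c_eq_sum_rank_drop: "l_c Y a b = (\<Sum>t\<in>support_on {a<..b} (rank_drop Y). rank_drop Y t)"
  by (simp add: l_c_def supp_sum_def support_on_def rank_drop_def)

lemma l_c_append:
  assumes "finite_drops Y a b" "finite_drops Y b c" "a \<le> b" "b \<le> c"
  shows "finite_drops Y a c" "l_c Y a c = l_c Y a b + l_c Y b c"
proof -
  have eq: "support_on {a<..c} (rank_drop Y) = support_on {a<..b} (rank_drop Y) \<union> support_on {b<..c} (rank_drop Y)"
    using assms(3,4) by (auto simp: support_on_def)
  then show "finite_drops Y a c" using assms(1,2) by (simp add: finite_drops_def)
  show "l_c Y a c = l_c Y a b + l_c Y b c"
    unfolding l_c_eq_sum_rank_drop eq using assms(1,2)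
    by (intro sum.union_disjoint) (auto simp: finite_drops_def support_on_def)
qed

lemma rank_drop_eq_if_rank_constant_left:
  assumes "u < t" "\<And>s. u < s \<Longrightarrow> s < t \<Longrightarrow> rank (upper_block (Y s)) = r"
  shows "rank_drop Y t = int r - int (rank (upper_block (Y t)))"
proof -
  have "\<forall>\<^sub>F s in at_left t. int (rank (upper_block (Y s))) = int r"
    using assms by (auto simp: eventually_at_left[OF assms(1)] intro!: exI[of _ u])
  then have "((\<lambda>s. int (rank (upper_block (Y s)))) \<longlongrightarrow> int r) (at_left t)"
    by (rule tendsto_eventually)
  then have "Lim (at_left t) (\<lambda>s. int (rank (upper_block (Y s)))) = int r"
    by (intro tendsto_Lim) (auto simp: trivial_limit_at_left_real)
  then show ?thesis by (simp add: rank_drop_def)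
qed

lemma eventually_constant_if_antimono_nat:
  fixes i :: "real \<Rightarrow> nat"
  assumes "a < b" and mono: "\<And>s t. a < s \<Longrightarrow> s \<le> t \<Longrightarrow> t < b \<Longrightarrow> i t \<le> i s"
  obtains t0 where "a < t0" "t0 < b" "\<And>t. t0 \<le> t \<Longrightarrow> t < b \<Longrightarrow> i t = i t0"
proof -
  have "\<exists>t0. (a < t0 \<and> t0 < b) \<and> (\<forall>t. a < t \<and> t < b \<longrightarrow> i t0 \<le> i t)"
    using ex_has_least_nat[of "\<lambda>t. a < t \<and> t < b" _ i] dense[OF assms(1)] by blast
  then obtain t0 where t0: "a < t0" "t0 < b" "\<And>t. a < t \<Longrightarrow> t < b \<Longrightarrow> i t0 \<le> i t" by blast
  have "i t = i t0" if "t0 \<le> t" "t < b" for t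
    using mono[of t0 t] t0(3)[of t] t0(1) that by fastforce
  then show thesis using that t0(1,2) by blast
qed

text \<open>Close to \<open>\<tau>\<close>, lower semicontinuity and monotonicity make \<open>ind Q\<close> constant on \<open>[\<tau>, \<tau> + \<delta>)\<close> and
  \<open>ind (- Q)\<close> constant on \<open>(\<tau> - \<delta>, \<tau>]\<close>, and both are constant on either side of \<open>\<tau>\<close>, being monotone
  with values in the natural numbers. So the rank can drop at \<open>\<tau>\<close> only, by the amount that
  \<open>ind Q\<close> loses there.\<close>

lemma l_c_eq_ind_diff_local:
  fixes Y :: "real \<Rightarrow> real^'n::finite^('n + 'n)" and Q :: "real \<Rightarrow> real^'n^'n"
  assumes "e > 0" and cont: "continuous_on {\<tau> - e<..<\<tau> + e} Q"
    and sym: "\<And>t. t \<in> {\<tau> - e<..<\<tau> + e} \<Longrightarrow> symmetric_mat (Q t)"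
    and mono: "\<And>s t v. s \<in> {\<tau> - e<..<\<tau> + e} \<Longrightarrow> t \<in> {\<tau> - e<..<\<tau> + e} \<Longrightarrow> s \<le> t
        \<Longrightarrow> v \<bullet> (Q s *v v) \<le> v \<bullet> (Q t *v v)"
    and rank: "\<And>t. t \<in> {\<tau> - e<..<\<tau> + e} \<Longrightarrow> rank (upper_block (Y t)) = rank (Q t)"
  shows "\<exists>\<delta>>0. \<forall>c d. c \<le> \<tau> \<and> \<tau> \<le> d \<and> d - c < \<delta> \<longrightarrow>
      finite_drops Y c d \<and> l_c Y c d = int (ind (Q c)) - int (ind (Q d))"
proof -
  let ?I = "{\<tau> - e<..<\<tau> + e}"
  define i where "i = (\<lambda>t. ind (Q t))"
  define j where "j = (\<lambda>t. ind (- Q t))"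
  define r where "r = (\<lambda>t. rank (upper_block (Y t)))"
  have \<tau>: "\<tau> \<in> ?I" using \<open>e > 0\<close> by simp
  have rij: "r t = i t + j t" if "t \<in> ?I" for t
    unfolding r_def i_def j_def rank[OF that] by (rule rank_eq_ind_plus_ind_uminus[OF sym[OF that]])
  have anti: "i t \<le> i s" if "s \<in> ?I" "t \<in> ?I" "s \<le> t" for s t
    unfolding i_def by (intro ind_antimono sym mono that)
  have mon: "j s \<le> j t" if "s \<in> ?I" "t \<in> ?I" "s \<le> t" for s t
    unfolding j_def using mono[OF that]
    by (intro ind_antimono symmetric_mat_uminus sym that) (simp add: uminus_matrix_vector)
  have contm: "continuous_on ?I (\<lambda>x. - Q x)" using cont by (intro continuous_intros)
  obtain d1 where d1: "d1 > 0" "\<And>t. t \<in> ?I \<Longrightarrow> dist t \<tau> < d1 \<Longrightarrow> i \<tau> \<le> i t"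
    using ind_lower_semicontinuous[OF cont sym \<tau>] unfolding i_def by blast
  obtain d2 where d2: "d2 > 0" "\<And>t. t \<in> ?I \<Longrightarrow> dist t \<tau> < d2 \<Longrightarrow> j \<tau> \<le> j t"
    using ind_lower_semicontinuous[OF contm symmetric_mat_uminus[OF sym] \<tau>] unfolding j_def by blast
  have "\<tau> - e < \<tau>" "- \<tau> - e < - \<tau>" using \<open>e > 0\<close> by auto
  note lt = this
  have antiL: "i t \<le> i s" if "\<tau> - e < s" "s \<le> t" "t < \<tau>" for s t
    using that \<open>e > 0\<close> by (intro anti) auto
  have antiR: "j (- t) \<le> j (- s)" if "- \<tau> - e < s" "s \<le> t" "t < - \<tau>" for s t
    using that \<open>e > 0\<close> by (intro mon) auto
  from eventually_constant_if_antimono_nat[where i = i, OF lt(1) antiL]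
  obtain t0 where t0: "\<tau> - e < t0" "t0 < \<tau>" "\<And>t. t0 \<le> t \<Longrightarrow> t < \<tau> \<Longrightarrow> i t = i t0" by blast
  \<comment> \<open>Reflection turns the nondecreasing \<open>j\<close> to the right of \<open>\<tau>\<close> into a nonincreasing function to the
    left of \<open>- \<tau>\<close>.\<close>
  from eventually_constant_if_antimono_nat[where i = "\<lambda>t. j (- t)", OF lt(2) antiR]
  obtain t1 where t1: "- \<tau> - e < t1" "t1 < - \<tau>" "\<And>t. t1 \<le> t \<Longrightarrow> t < - \<tau> \<Longrightarrow> j (- t) = j (- t1)"
    by blast
  define \<delta> where "\<delta> = Min {e, d1, d2, \<tau> - t0, - \<tau> - t1}"
  have \<delta>: "\<delta> > 0" "\<delta> \<le> e" "\<delta> \<le> d1" "\<delta> \<le> d2" "\<delta> \<le> \<tau> - t0" "\<delta> \<le> - \<tau> - t1"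
    unfolding \<delta>_def using \<open>e > 0\<close> d1(1) d2(1) t0(2) t1(2) by auto
  have iR: "i t = i \<tau>" if "\<tau> \<le> t" "t < \<tau> + \<delta>" for t
    using anti[OF \<tau>, of t] d1(2)[of t] that \<delta> by (auto simp: dist_real_def)
  have jL: "j t = j \<tau>" if "t \<le> \<tau>" "\<tau> - \<delta> < t" for t
    using mon[OF _ \<tau>, of t] d2(2)[of t] that \<delta> by (auto simp: dist_real_def)
  have iL: "i t = i t0" if "t < \<tau>" "\<tau> - \<delta> < t" for t
    using t0(3)[of t] that \<delta> by simp
  have jR: "j t = j (- t1)" if "\<tau> < t" "t < \<tau> + \<delta>" for t
    using t1(3)[of "- t"] that \<delta> by simp
  have rL: "r t = i t0 + j \<tau>" if "t < \<tau>" "\<tau> - \<delta> < t" for t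
    using rij[of t] iL[of t] jL[of t] that \<delta> by simp
  have rR: "r t = i \<tau> + j (- t1)" if "\<tau> < t" "t < \<tau> + \<delta>" for t
    using rij[of t] iR[of t] jR[of t] that \<delta> by simp
  have dropL: "rank_drop Y t = int (i t0 + j \<tau>) - int (r t)" if "t \<le> \<tau>" "\<tau> - \<delta> < t" for t
    unfolding r_def by (rule rank_drop_eq_if_rank_constant_left[OF that(2)]) (use rL that in \<open>auto simp: r_def\<close>)
  have dropR: "rank_drop Y t = int (i \<tau> + j (- t1)) - int (r t)" if "\<tau> < t" "t < \<tau> + \<delta>" for t
    unfolding r_def by (rule rank_drop_eq_if_rank_constant_left[OF that(1)]) (use rR that in \<open>auto simp: r_def\<close>)
  have drop0: "rank_drop Y t = 0" if "\<tau> - \<delta> < t" "t < \<tau> + \<delta>" "t \<noteq> \<tau>" for t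
    using dropL[of t] dropR[of t] rL[of t] rR[of t] that by (cases "t < \<tau>") auto
  have drop\<tau>: "rank_drop Y \<tau> = int (i t0) - int (i \<tau>)"
    using dropL[of \<tau>] rij[OF \<tau>] \<delta>(1) by simp
  have "finite_drops Y c d \<and> l_c Y c d = int (i c) - int (i d)" if "c \<le> \<tau>" "\<tau> \<le> d" "d - c < \<delta>" for c d
  proof -
    have sub: "support_on {c<..d} (rank_drop Y) \<subseteq> {\<tau>} \<inter> {c<..d}"
    proof
      fix t assume t: "t \<in> support_on {c<..d} (rank_drop Y)"
      then show "t \<in> {\<tau>} \<inter> {c<..d}"
        using drop0[of t] that by (cases "t = \<tau>") (auto simp: support_on_def)
    qed
    have "l_c Y c d = (\<Sum>t\<in>{\<tau>} \<inter> {c<..d}. rank_drop Y t)"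
      unfolding l_c_eq_sum_rank_drop
      using sub by (intro sum.mono_neutral_left) (auto simp: support_on_def)
    also have "\<dots> = int (i c) - int (i d)"
    proof (cases "c = \<tau>")
      case True
      then show ?thesis using iR[of d] that by simp
    next
      case False
      then show ?thesis using iR[of d] iL[of c] that drop\<tau> by simp
    qed
    finally show ?thesis
      using finite_subset[OF sub] by (simp add: finite_drops_def)
  qed
  then show ?thesis using \<delta>(1) by (auto simp: i_def)
qed

section \<open>The focal point formula\<close>

text \<open>\<open>Y'\<close> plays the role of \<open>Y\<^sub>k\<^sub>+\<^sub>1\<close> and \<open>Y\<close> that of \<open>Y\<^sub>k\<close>. The two parameters of \<open>L s t = W t Z s (0; I)\<close> separate the
  two sources of motion: the path \<open>L s s\<close> governs \<open>Y'\<close>, the path \<open>L s \<tau>\<close>, compared with the fixed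
  subspace of \<open>V \<tau>\<close>, governs \<open>Y\<close>.\<close>

lemma focal_points_local:
  fixes W Z :: "real \<Rightarrow> real^('n::finite + 'n)^('n + 'n)"
  assumes W: "monotone_symplectic W" and Z: "monotone_symplectic Z"
  defines "V \<equiv> \<lambda>t. W t ** (col0I :: real^'n^('n + 'n))"
    and "Y \<equiv> \<lambda>t. Z t ** (col0I :: real^'n^('n + 'n))"
    and "Y' \<equiv> \<lambda>t. W t ** Z t ** (col0I :: real^'n^('n + 'n))"
  shows "\<exists>\<delta>>0. \<forall>c d. c \<le> \<tau> \<and> \<tau> \<le> d \<and> d - c < \<delta> \<longrightarrow>
      finite_drops Y c d \<and> finite_drops Y' c d \<and> finite_drops V c d \<and>
      l_c Y c d - l_c Y' c d + l_c V c d
        = int (comparative_index (Y' c) (V c)) - int (comparative_index (Y' d) (V d))"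
proof -
  have symp: "symplectic (W t)" "symplectic (Z t)" for t
    using W Z by (auto simp: monotone_symplectic_def)
  have cont: "continuous_on UNIV W" "continuous_on UNIV Z"
    using W Z by (auto simp: monotone_symplectic_def)
  have V_def': "W t ** col0I = V t" for t by (simp add: V_def)
  define L where "L = (\<lambda>s t. W t ** Y s)"
  have L_diag: "Y' t = L t t" for t by (simp add: L_def Y_def Y'_def matrix_mul_assoc)
  have lagY: "lagrangian (Y t)" and lagV: "lagrangian (V t)" for t
    unfolding Y_def V_def by (intro lagrangian_symplectic_mult symp lagrangian_col0I)+
  have lagL: "lagrangian (L s t)" for s t
    unfolding L_def by (intro lagrangian_symplectic_mult symp lagY)
  have w: "wronskian (L s t) (V t) = transpose (upper_block (Y s))" for s t
    unfolding L_def V_def by (simp add: wronskian_symplectic[OF symp(1)] wronskian_col0I)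
  have "finite ({k. \<not> invertible (sheared_lower k (L \<tau> \<tau>))} \<union> {k. \<not> invertible (sheared_lower k (V \<tau>))})"
    using finite_singular_shears[OF lagL] finite_singular_shears[OF lagV] by simp
  then obtain k where k: "invertible (sheared_lower k (L \<tau> \<tau>))" "invertible (sheared_lower k (V \<tau>))"
    using ex_new_if_finite[OF infinite_UNIV_char_0] by blast

  have contL: "continuous_on UNIV (\<lambda>p. L (fst p) (snd p))"
    unfolding L_def Y_def
    by (intro continuous_intros continuous_on_compose2[OF cont(1)] continuous_on_compose2[OF cont(2)]) auto
  have contV: "continuous_on UNIV V"
    unfolding V_def by (intro continuous_intros cont)
  let ?D = "{p. det (sheared_lower k (L (fst p) (snd p))) \<noteq> 0} \<inter> {p. det (sheared_lower k (V (snd p))) \<noteq> 0}"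
  have "open ?D"
    by (intro open_Int open_Collect_neq continuous_on_det continuous_intros contL
        continuous_on_compose2[OF contV]) auto
  moreover have "(\<tau>, \<tau>) \<in> ?D" using k by (simp add: invertible_det_nz)
  ultimately obtain \<epsilon> where \<epsilon>: "\<epsilon> > 0" "ball (\<tau>, \<tau>) \<epsilon> \<subseteq> ?D"
    using openE by blast
  define e where "e = \<epsilon> / 2"
  define I where "I = {\<tau> - e<..<\<tau> + e}"
  have "e > 0" using \<epsilon>(1) by (simp add: e_def)
  have \<tau>I: "\<tau> \<in> I" using \<open>e > 0\<close> by (simp add: I_def)
  have inv: "invertible (sheared_lower k (L s t))" "invertible (sheared_lower k (V t))"
    if "s \<in> I" "t \<in> I" for s t
  proof -
    have "dist (\<tau>, \<tau>) (s, t) \<le> dist \<tau> s + dist \<tau> t"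
      by (simp add: dist_Pair_Pair sqrt_sum_squares_le_sum)
    also have "\<dots> < \<epsilon>" using that by (auto simp: I_def e_def dist_real_def)
    finally have "(s, t) \<in> ?D" using \<epsilon>(2) by (meson mem_ball subsetD)
    then show "invertible (sheared_lower k (L s t))" "invertible (sheared_lower k (V t))"
      by (auto simp: invertible_det_nz)
  qed
  have between: "r \<in> I" if "r \<in> {s..t}" "s \<in> I" "t \<in> I" for r s t using that by (auto simp: I_def)
  define P where "P = (\<lambda>s t. slope k (L s t))"
  define R where "R = (\<lambda>t. slope k (V t))"
  have symP: "symmetric_mat (P s t)" and symR: "symmetric_mat (R t)" if "s \<in> I" "t \<in> I" for s t
    unfolding P_def R_def using that by (intro symmetric_slope lagL lagV inv; simp)+
  have symPR: "symmetric_mat (P s t - R t)" if "s \<in> I" "t \<in> I" for s t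
    using symP[OF that] symR[OF that] by (simp add: symmetric_mat_def transpose_linear_simps)
  have contP: "continuous_on (I \<times> I) (\<lambda>p. P (fst p) (snd p))"
    unfolding P_def using inv
    by (intro continuous_on_slope continuous_on_subset[OF contL]) auto
  have contR: "continuous_on I R"
    unfolding R_def using inv \<tau>I by (intro continuous_on_slope continuous_on_subset[OF contV]) auto
  have contP_comp: "continuous_on I (\<lambda>t. P (f t) (g t))"
    if "continuous_on I f" "continuous_on I g" "\<And>t. t \<in> I \<Longrightarrow> f t \<in> I \<and> g t \<in> I" for f g
  proof -
    have "continuous_on I (\<lambda>t. P (fst (f t, g t)) (snd (f t, g t)))"
      using that by (intro continuous_on_compose2[OF contP] continuous_on_Pair) auto
    then show ?thesis by simp
  qed

  have mono_diag: "v \<bullet> (P s s *v v) \<le> v \<bullet> (P t t *v v)" if "s \<in> I" "t \<in> I" "s \<le> t" for s t v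
  proof -
    have "(W r ** Z r) ** col0I = L r r" for r by (simp add: L_def Y_def matrix_mul_assoc)
    then show ?thesis
      using slope_nondecreasing[OF monotone_symplectic_mult[OF W Z] lagrangian_col0I that(3), of k v]
        inv between[OF _ that(1,2)] unfolding P_def by simp
  qed
  have mono_fst: "v \<bullet> (P s \<tau> *v v) \<le> v \<bullet> (P t \<tau> *v v)" if "s \<in> I" "t \<in> I" "s \<le> t" for s t v
  proof -
    have "(W \<tau> ** Z r) ** col0I = L r \<tau>" for r by (simp add: L_def Y_def matrix_mul_assoc)
    then show ?thesis
      using slope_nondecreasing[OF monotone_symplectic_mult[OF monotone_symplectic_const[OF symp(1)[of \<tau>]] Z]
          lagrangian_col0I that(3), of k v]
        inv \<tau>I between[OF _ that(1,2)] unfolding P_def by simp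
  qed
  have mono_R: "v \<bullet> (R s *v v) \<le> v \<bullet> (R t *v v)" if "s \<in> I" "t \<in> I" "s \<le> t" for s t v
    using slope_nondecreasing[OF W lagrangian_col0I that(3), of k v]
        inv \<tau>I between[OF _ that(1,2)] unfolding R_def V_def' by simp
  \<comment> \<open>The intersection of the subspaces of \<open>L s t\<close> and \<open>V t\<close> has a dimension that does not depend on \<open>t\<close>.\<close>
  have rank_PR: "rank (P s t - R t) = rank (upper_block (Y s))" if "s \<in> I" "t \<in> I" for s t
    unfolding P_def R_def using rank_slope_diff[OF lagL inv[OF that]]
    by (simp add: w rank_transpose)

  have rank_P: "rank (upper_block (Y' t)) = rank (P t t)" if "t \<in> I" for t
    by (simp add: L_diag P_def rank_upper_block_eq_rank_slope[OF inv(1)[OF that that]])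
  have rank_R: "rank (upper_block (V t)) = rank (R t)" if "t \<in> I" for t
    by (simp add: R_def rank_upper_block_eq_rank_slope[OF inv(2)[OF that that]])

  have "\<exists>\<delta>>0. \<forall>c d. c \<le> \<tau> \<and> \<tau> \<le> d \<and> d - c < \<delta> \<longrightarrow> finite_drops Y' c d \<and>
      l_c Y' c d = int (ind (P c c)) - int (ind (P d d))"
    by (rule l_c_eq_ind_diff_local[of e \<tau> "\<lambda>t. P t t" Y', folded I_def, OF \<open>e > 0\<close>])
      (use contP_comp symP rank_P mono_diag in auto)
  then obtain \<delta>1 where \<delta>1: "\<delta>1 > 0" "\<And>c d. c \<le> \<tau> \<Longrightarrow> \<tau> \<le> d \<Longrightarrow> d - c < \<delta>1 \<Longrightarrow>
      finite_drops Y' c d \<and> l_c Y' c d = int (ind (P c c)) - int (ind (P d d))"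
    by blast
  have "\<exists>\<delta>>0. \<forall>c d. c \<le> \<tau> \<and> \<tau> \<le> d \<and> d - c < \<delta> \<longrightarrow> finite_drops V c d \<and>
      l_c V c d = int (ind (R c)) - int (ind (R d))"
    by (rule l_c_eq_ind_diff_local[of e \<tau> R V, folded I_def, OF \<open>e > 0\<close>])
      (use contR symR rank_R mono_R in auto)
  then obtain \<delta>2 where \<delta>2: "\<delta>2 > 0" "\<And>c d. c \<le> \<tau> \<Longrightarrow> \<tau> \<le> d \<Longrightarrow> d - c < \<delta>2 \<Longrightarrow>
      finite_drops V c d \<and> l_c V c d = int (ind (R c)) - int (ind (R d))"
    by blast
  have "\<exists>\<delta>>0. \<forall>c d. c \<le> \<tau> \<and> \<tau> \<le> d \<and> d - c < \<delta> \<longrightarrow> finite_drops Y c d \<and>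
      l_c Y c d = int (ind (P c \<tau> - R \<tau>)) - int (ind (P d \<tau> - R \<tau>))"
  proof (rule l_c_eq_ind_diff_local[of e \<tau> "\<lambda>t. P t \<tau> - R \<tau>" Y, folded I_def, OF \<open>e > 0\<close>])
    show "continuous_on I (\<lambda>t. P t \<tau> - R \<tau>)"
      using \<tau>I by (intro continuous_on_diff contP_comp) auto
  qed (use symPR rank_PR mono_fst \<tau>I in \<open>auto simp: matrix_vector_mult_diff_rdistrib inner_diff_right\<close>)
  then obtain \<delta>3 where \<delta>3: "\<delta>3 > 0" "\<And>c d. c \<le> \<tau> \<Longrightarrow> \<tau> \<le> d \<Longrightarrow> d - c < \<delta>3 \<Longrightarrow>
      finite_drops Y c d \<and> l_c Y c d = int (ind (P c \<tau> - R \<tau>)) - int (ind (P d \<tau> - R \<tau>))"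
    by blast
  \<comment> \<open>Moving \<open>W\<close> from parameter \<open>\<tau>\<close> to \<open>s\<close> at fixed \<open>Z s\<close> keeps the rank of the difference of slopes.\<close>
  have ind_PR: "ind (P s \<tau> - R \<tau>) = ind (P s s - R s)" if "s \<in> I" for s
  proof (rule ind_constant_if_rank_constant[of I "\<lambda>t. P s t - R t" "rank (upper_block (Y s))" \<tau> s])
    show "connected I" by (simp add: I_def)
    show "continuous_on I (\<lambda>t. P s t - R t)"
      using that by (intro continuous_on_diff contP_comp contR) auto
  qed (use that \<tau>I symPR rank_PR in auto)
  have ci: "int (comparative_index (Y' t) (V t)) = int (ind (P t t - R t)) + int (ind (R t)) - int (ind (P t t))"
    if "t \<in> I" for t
    using comparative_index_slope[OF lagL lagV inv[OF that that]] unfolding L_diag P_def R_def by linarith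
  define \<delta> where "\<delta> = Min {e, \<delta>1, \<delta>2, \<delta>3}"
  have "\<delta> > 0" unfolding \<delta>_def using \<open>e > 0\<close> \<delta>1(1) \<delta>2(1) \<delta>3(1) by simp
  moreover have "finite_drops Y c d \<and> finite_drops Y' c d \<and> finite_drops V c d \<and>
      l_c Y c d - l_c Y' c d + l_c V c d
        = int (comparative_index (Y' c) (V c)) - int (comparative_index (Y' d) (V d))"
    if "c \<le> \<tau>" "\<tau> \<le> d" "d - c < \<delta>" for c d
  proof -
    have "d - c < e" "d - c < \<delta>1" "d - c < \<delta>2" "d - c < \<delta>3" using that(3) by (auto simp: \<delta>_def)
    then have "c \<in> I" "d \<in> I" using that by (auto simp: I_def)
    then show ?thesis
      using \<delta>1(2)[OF that(1,2) \<open>d - c < \<delta>1\<close>] \<delta>2(2)[OF that(1,2) \<open>d - c < \<delta>2\<close>]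
        \<delta>3(2)[OF that(1,2) \<open>d - c < \<delta>3\<close>] by (simp add: ci ind_PR)
  qed
  ultimately show ?thesis by blast
qed

text \<open>Both sides are additive in the interval, so the identity propagates from small intervals around each
  point by bisection.\<close>

lemma focal_points_comparative_index:
  fixes W Z :: "real \<Rightarrow> real^('n::finite + 'n)^('n + 'n)"
  assumes W: "monotone_symplectic W" and Z: "monotone_symplectic Z" and "a \<le> b"
  defines "V \<equiv> \<lambda>t. W t ** (col0I :: real^'n^('n + 'n))"
    and "Y \<equiv> \<lambda>t. Z t ** (col0I :: real^'n^('n + 'n))"
    and "Y' \<equiv> \<lambda>t. W t ** Z t ** (col0I :: real^'n^('n + 'n))"
  shows "l_c Y a b - l_c Y' a b + l_c V a b
        = int (comparative_index (Y' a) (V a)) - int (comparative_index (Y' b) (V b))"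
proof -
  have "finite_drops Y a b \<and> finite_drops Y' a b \<and> finite_drops V a b \<and>
      l_c Y a b - l_c Y' a b + l_c V a b
        = int (comparative_index (Y' a) (V a)) - int (comparative_index (Y' b) (V b))"
    using \<open>a \<le> b\<close>
  proof (induction rule: Bolzano)
    case (trans a b c)
    then show ?case
      using l_c_append[of Y a b c] l_c_append[of Y' a b c] l_c_append[of V a b c] by simp
  next
    case (local x)
    show ?case
      using focal_points_local[OF W Z, of x] unfolding V_def Y_def Y'_def .
  qed
  then show ?thesis by simp
qed

text \<open>The two definitions coincide term by term once the Wronskian of \<open>W Y\<close> and \<open>W (0; I)\<close> is identified
  with the transpose of the upper block of \<open>Y\<close>.\<close>

lemma m_d_eq_comparative_index:
  assumes "symplectic (W k)" "Y (Suc k) = W k ** Y k"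
  shows "m_d W Y k = comparative_index (Y (Suc k)) (W k ** col0I)"
proof -
  have "transpose (wronskian (Y (Suc k)) (W k ** col0I)) = upper_block (Y k)"
    unfolding assms(2) by (simp add: wronskian_symplectic[OF assms(1)] wronskian_col0I)
  then show ?thesis
    by (simp add: m_d_def comparative_index_def upper_block_mult_col0I)
qed

theorem theorem3p5:
  fixes N :: nat
    and W Z :: "nat \<Rightarrow> real \<Rightarrow> real^('n::finite + 'n)^('n + 'n)"
    and Y :: "nat \<Rightarrow> real \<Rightarrow> real^'n^('n + 'n)"
    and a b :: real
  assumes "\<And>k t. k \<le> N \<Longrightarrow> symplectic (W k t)"
    and "\<And>k. k \<le> N \<Longrightarrow> C1p (W k)"
    and "\<And>k. k \<le> N \<Longrightarrow> Psi_nonneg (W k)"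
    and "\<And>t. symplectic_fundamental_matrix N (\<lambda>k. W k t) (\<lambda>k. Z k t)"
    and "C1p (Z 0)"
    and "Psi_nonneg (Z 0)"
    and "\<And>t. conjoined_basis N (\<lambda>k. W k t) (\<lambda>k. Y k t)"
    and "\<And>t. Y 0 t = Z 0 t ** col0I"
    and "a < b"
  shows "(\<forall>k\<le>N.
            - (l_c (Y (Suc k)) a b - l_c (Y k) a b) + l_c (\<lambda>t. W k t ** col0I) a b
              = int (comparative_index (Y (Suc k) a) (W k a ** col0I))
                - int (comparative_index (Y (Suc k) b) (W k b ** col0I)) \<and>
            int (comparative_index (Y (Suc k) a) (W k a ** col0I))
                - int (comparative_index (Y (Suc k) b) (W k b ** col0I))
              = int (m_d (\<lambda>k. W k a) (\<lambda>k. Y k a) k) - int (m_d (\<lambda>k. W k b) (\<lambda>k. Y k b) k)) \<and>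
         l_c (Y (N + 1)) a b - l_c (Y 0) a b - (\<Sum>k=0..N. l_c (\<lambda>t. W k t ** col0I) a b)
           = int (l_d (\<lambda>k. W k b) (\<lambda>k. Y k b) 0 (N + 1))
             - int (l_d (\<lambda>k. W k a) (\<lambda>k. Y k a) 0 (N + 1))"
proof -
  have monW: "monotone_symplectic (W k)" if "k \<le> N" for k
    using that assms(1-3) by (intro monotone_symplectic_if_Psi_nonneg)
  have Z_Suc: "Z (Suc k) = (\<lambda>t. W k t ** Z k t)" if "k \<le> N" for k
    using assms(4) that by (auto simp: symplectic_fundamental_matrix_def)
  have Y_Suc: "Y (Suc k) t = W k t ** Y k t" if "k \<le> N" for k t
    using assms(7) that by (auto simp: conjoined_basis_def)
  have monZ: "monotone_symplectic (Z k)" if "k \<le> Suc N" for k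
    using that
  proof (induction k)
    case 0
    have "symplectic (Z 0 t)" for t
      using assms(4)[of t] by (simp add: symplectic_fundamental_matrix_def)
    then show ?case using assms(5,6) by (intro monotone_symplectic_if_Psi_nonneg)
  next
    case (Suc k)
    then show ?case using monW[of k] by (simp add: Z_Suc monotone_symplectic_mult)
  qed
  have Y_eq: "Y k = (\<lambda>t. Z k t ** col0I)" if "k \<le> Suc N" for k
    using that
  proof (induction k)
    case (Suc k)
    then show ?case by (simp add: fun_eq_iff Y_Suc Z_Suc matrix_mul_assoc)
  qed (simp add: fun_eq_iff assms(8))
  have one: "- (l_c (Y (Suc k)) a b - l_c (Y k) a b) + l_c (\<lambda>t. W k t ** col0I) a b
      = int (comparative_index (Y (Suc k) a) (W k a ** col0I))
        - int (comparative_index (Y (Suc k) b) (W k b ** col0I))" if "k \<le> N" for k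
    using focal_points_comparative_index[OF monW[OF that] monZ[of k], of a b] that \<open>a < b\<close>
    by (simp add: Y_eq Z_Suc)
  have two: "comparative_index (Y (Suc k) t) (W k t ** col0I) = m_d (\<lambda>k. W k t) (\<lambda>k. Y k t) k"
    if "k \<le> N" for k t
    using m_d_eq_comparative_index[of "\<lambda>k. W k t" k "\<lambda>k. Y k t"] assms(1) Y_Suc that by simp
  \<comment> \<open>Telescoping the one-step identity over \<open>k\<close>.\<close>
  have "l_c (Y (M + 1)) a b - l_c (Y 0) a b - (\<Sum>k=0..M. l_c (\<lambda>t. W k t ** col0I) a b)
      = (\<Sum>k=0..M. int (m_d (\<lambda>k. W k b) (\<lambda>k. Y k b) k)) - (\<Sum>k=0..M. int (m_d (\<lambda>k. W k a) (\<lambda>k. Y k a) k))"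
    if "M \<le> N" for M
    using that
  proof (induction M)
    case 0
    then show ?case using one[of 0] by (simp add: two)
  next
    case (Suc M)
    then show ?case using one[of "Suc M"] by (simp add: two)
  qed
  from this[of N] show ?thesis
    using one by (simp add: two l_d_def atLeastLessThanSuc_atLeastAtMost)
qed

end
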